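(* Consider Problem (P) under Assumptions A1–A6 and B1–B2, with surrogates $\widetilde f_i$ satisfying F1–F3. Let $\{\mathbf{x}[n]\}_n=\{(\mathbf{x}_i[n])_{i=1}^I\}_n$ be generated by the inexact NEXT iteration with tolerances $\varepsilon_i[n]\ge0$ (a bounded sequence for each $i$), and let $\overline{\mathbf{x}}[n]=\frac1I\sum_i\mathbf{x}_i[n]$. Suppose $\alpha[n]\in(0,1]$ for all $n$, $\sum_n\alpha[n]=\infty$, $\sum_n\alpha[n]^2<\infty$, and $\sum_{n=0}^\infty\alpha[n]\varepsilon_i[n]<\infty$ for all $i$. Then (a) $\{\overline{\mathbf{x}}[n]\}_n$ is bounded and all its limit points are stationary solutions of (P); (b) $\|\mathbf{x}_i[n]-\overline{\mathbf{x}}[n]\|\to0$ for all $i$.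
   Context: Problem (P): minimize $U(\mathbf{x})=F(\mathbf{x})+G(\mathbf{x})$ subject to $\mathbf{x}\in\mathcal K\subseteq\mathbb R^m$, where $F=\sum_{i=1}^I f_i$. Assumptions: (A1) $\mathcal K$ nonempty, closed, convex; (A2) each $f_i:\mathbb R^m\to\mathbb R$ is $C^1$ (possibly nonconvex) on an open set containing $\mathcal K$; (A3) each $\nabla f_i$ is Lipschitz on $\mathcal K$ with constant $L_i$; (A4) $\|\nabla F(\mathbf{x})\|\le L_F$ on $\mathcal K$ for some finite $L_F$; (A5) $G$ is convex (possibly nonsmooth) with all subgradients on $\mathcal K$ bounded in norm by some finite $L_G$; (A6) $U$ is coercive on $\mathcal K$. A point $\mathbf{x}^*\in\mathcal K$ is a stationary solution of (P) if there is a subgradient $\boldsymbol\xi\in\partial G(\mathbf{x}^* )$ with $(\nabla F(\mathbf{x}^* )+\boldsymbol\xi)^T(\mathbf{y}-\mathbf{x}^* )\ge0$ for all $\mathbf{y}\in\mathcal K$. Network: at each time $n$ a digraph $\mathcal G[n]=(\{1,\dots,I\},\mathcal E[n])$; $\mathcal N_i^{\rm in}[n]=\{j:(j,i)\in\mathcal E[n]\}\cup\{i\}$. Weights: $w_{ij}[n]=\theta_{ij}\in[\vartheta,1]$ if $j\in\mathcal N_i^{\rm in}[n]$ and $w_{ij}[n]=0$ otherwise, for a fixed $\vartheta\in(0,1)$; $\mathbf W[n]=(w_{ij}[n])$. (B1) there is an integer $B>0$ such that for every $k\ge0$ the graph with edge set $\bigcup_{n=kB}^{(k+1)B-1}\mathcal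 E[n]$ is strongly connected; (B2) $\mathbf W[n]\mathbf 1=\mathbf 1$ and $\mathbf 1^T\mathbf W[n]=\mathbf 1^T$ for all $n$. Surrogates $\widetilde f_i(\cdot;\mathbf{x}):\mathcal K\to\mathbb R$ (differentiable in the first argument) satisfy: (F1) $\widetilde f_i(\cdot;\mathbf{x})$ is strongly convex on $\mathcal K$ with constant $\tau_i>0$ uniformly in $\mathbf{x}\in\mathcal K$; (F2) $\nabla\widetilde f_i(\mathbf{x};\mathbf{x})=\nabla f_i(\mathbf{x})$ for all $\mathbf{x}\in\mathcal K$ (gradient w.r.t. the first argument); (F3) $\nabla\widetilde f_i(\mathbf{x};\cdot)$ is Lipschitz on $\mathcal K$ uniformly in $\mathbf{x}\in\mathcal K$. NEXT iteration (inexact version; the exact version has $\varepsilon_i[n]=0$): initialize $\mathbf{x}_i[0]\in\mathcal K$, $\mathbf y_i[0]=\nabla f_i(\mathbf{x}_i[0])$, $\widetilde{\boldsymbol\pi}_i[0]=I\mathbf y_i[0]-\nabla f_i(\mathbf{x}_i[0])$. For $n\ge0$ each agent $i$: computes $\widetilde{\mathbf{x}}_i[n]=\arg\min_{\mathbf{x}\in\mathcal K}\{\widetilde f_i(\mathbf{x};\mathbf{x}_i[n])+\widetilde{\boldsymbol\pi}_i[n]^T(\mathbf{x}-\mathbf{x}_i[n])+G(\mathbf{x})\}$; picks $\mathbf{x}_i^{\rm inx}[n]\in\mathcal K$ with $\|\mathbf{x}_i^{\rm inx}[n]-\widetilde{\mathbf{x}}_i[n]\|\le\varepsilon_i[n]$;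 sets $\mathbf z_i[n]=\mathbf{x}_i[n]+\alpha[n](\mathbf{x}_i^{\rm inx}[n]-\mathbf{x}_i[n])$; then $\mathbf{x}_i[n+1]=\sum_{j=1}^I w_{ij}[n]\mathbf z_j[n]$, $\mathbf y_i[n+1]=\sum_{j=1}^I w_{ij}[n]\mathbf y_j[n]+\nabla f_i(\mathbf{x}_i[n+1])-\nabla f_i(\mathbf{x}_i[n])$, $\widetilde{\boldsymbol\pi}_i[n+1]=I\mathbf y_i[n+1]-\nabla f_i(\mathbf{x}_i[n+1])$. *)

theory Defs
  imports "HOL-Analysis.Analysis"
begin

definition subdiff :: "('a::real_inner \<Rightarrow> real) \<Rightarrow> 'a \<Rightarrow> 'a set" where
  "subdiff G x = {\<xi>. \<forall>y. G y \<ge> G x + \<xi> \<bullet> (y - x)}"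

definition strongly_convex_on :: "'a::real_normed_vector set \<Rightarrow> real \<Rightarrow> ('a \<Rightarrow> real) \<Rightarrow> bool" where
  "strongly_convex_on S tau f \<longleftrightarrow> convex S \<and>
     (\<forall>x\<in>S. \<forall>y\<in>S. \<forall>t::real. 0 \<le> t \<and> t \<le> 1 \<longrightarrow>
        f (t *\<^sub>R x + (1 - t) *\<^sub>R y) \<le> t * f x + (1 - t) * f y - tau / 2 * t * (1 - t) * (norm (x - y))\<^sup>2)"

definition coercive_on :: "'a::real_normed_vector set \<Rightarrow> ('a \<Rightarrow> real) \<Rightarrow> bool" where
  "coercive_on K U \<longleftrightarrow> (\<forall>M. \<exists>R. \<forall>x\<in>K. norm x \<ge> R \<longrightarrow> U x \<ge> M)"

definition stationary :: "'a::real_inner set \<Rightarrow> ('a \<Rightarrow> 'a) \<Rightarrow> ('a \<Rightarrow> real) \<Rightarrow> 'a \<Rightarrow> bool" where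
  "stationary K gradF G x \<longleftrightarrow> x \<in> K \<and>
     (\<exists>\<xi>\<in>subdiff G x. \<forall>y\<in>K. (gradF x + \<xi>) \<bullet> (y - x) \<ge> 0)"

definition in_nbrs :: "(nat \<Rightarrow> (nat \<times> nat) set) \<Rightarrow> nat \<Rightarrow> nat \<Rightarrow> nat set" where
  "in_nbrs E n i = {j. (j, i) \<in> E n} \<union> {i}"

definition seq_limit_point :: "(nat \<Rightarrow> 'a::topological_space) \<Rightarrow> 'a \<Rightarrow> bool" where
  "seq_limit_point s p \<longleftrightarrow> (\<exists>r. strict_mono r \<and> (s \<circ> r) \<longlonglongrightarrow> p)"

end

theory Submission
  imports Defs
begin

text \<open>
  The disagreements \<open>X n\<close> of the \<open>x\<close> and \<open>Y n\<close> of the \<open>y\<close> variables are perturbed consensus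
  processes that feed into each other: directions are bounded by \<open>1 + X n + Y n\<close> because only the
  full gradient is bounded. As the direction enters with the factor \<open>\<alpha> n \<rightarrow> 0\<close>, a small-gain argument
  gives a majorant \<open>p\<close> of \<open>X + Y\<close> with \<open>p (n + 1) \<le> \<mu> p n + c \<alpha> n\<close>, \<open>\<mu> < 1\<close>; hence \<open>p\<close> is
  square summable.

  Comparing the minimizer \<open>xt n i\<close> with the average \<open>xb n\<close> in its own subproblem yields
  \<open>U (xb (n + 1)) \<le> U (xb n) - (\<tau> / I) \<alpha> n (\<Sum>i. |xt n i - xb n|^2) + s n\<close> with \<open>s\<close> summable, so
  \<open>xb\<close> is bounded and \<open>\<Sum>n. \<alpha> n |xt n i - xb n|^2\<close> is finite. Because \<open>|xt n i - xb n|\<close> grows by at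
  most \<open>O(\<alpha> n + p n)\<close> per step, it tends to zero, and the variational inequality for
  \<open>xt n i\<close> passes to the limit.
\<close>

section \<open>Real sequences\<close>

text \<open>Each \<open>gradf i\<close> may be unbounded on \<open>K\<close>, so the tracking
  variables have no a priori bound; only \<open>gradF\<close> is bounded, and the rest is paid for
  by disagreement. The gain from \<open>X\<close> to \<open>Y\<close> is not small, since mixing
  moves the iterates even under a zero step, but the loop closes through the directions only with
  the factor \<alpha>. Weighting \<open>X\<close> heavily therefore breaks it. Square summability of
  \<open>p\<close> is the right target because disagreement enters the descent estimate as
  \<open>\<alpha> n * p n\<close>, which lies below the sum of the squares. The average is the
  comparison point because it is common to all agents: their inequalities then add up to a bound on
  the change of \<open>U\<close> along the mean step. A summable weighted energy only makes the gap
  small infinitely often. Its growth bound rules out later excursions, but contains a term in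
  \<open>p n\<close> for which no bound by \<open>\<alpha> n\<close> alone is available; adding a
  multiple of \<open>p\<close> to the gap removes it.\<close>

lemma summable_of_contracting_recursion:
  fixes q r :: "nat \<Rightarrow> real"
  assumes q0: "\<And>n. 0 \<le> q n" and \<mu>: "0 \<le> \<mu>" "\<mu> < 1"
    and step: "\<And>n. q (Suc n) \<le> \<mu> * q n + r n"
    and r0: "\<And>n. 0 \<le> r n" and r: "summable r"
  shows "summable q"
proof (rule bounded_imp_summable[OF q0])
  fix n
  have "(\<Sum>k\<le>n. q k) \<le> q 0 + (\<Sum>k<n. q (Suc k))"
    by (simp add: lessThan_Suc_atMost[symmetric] sum.lessThan_Suc_shift del: sum.lessThan_Suc)
  also have "\<dots> \<le> q 0 + (\<Sum>k<n. \<mu> * q k + r k)"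
    by (intro add_left_mono sum_mono step)
  also have "\<dots> = q 0 + \<mu> * (\<Sum>k<n. q k) + (\<Sum>k<n. r k)"
    by (simp add: sum.distrib sum_distrib_left)
  also have "\<dots> \<le> q 0 + \<mu> * (\<Sum>k\<le>n. q k) + suminf r"
    using \<mu> q0 r0 r by (intro add_mono mult_left_mono sum_mono2 sum_le_suminf) auto
  \<comment> \<open>The partial sum stands on both sides; \<open>\<mu> < 1\<close> lets it be solved
    for.\<close>
  finally show "(\<Sum>k\<le>n. q k) \<le> (q 0 + suminf r) / (1 - \<mu>)"
    using \<mu> by (simp add: field_simps)
qed

lemma square_summable_of_contracting_recursion:
  fixes p \<alpha> :: "nat \<Rightarrow> real"
  assumes p0: "\<And>n. 0 \<le> p n" and \<mu>: "0 \<le> \<mu>" "\<mu> < 1"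
    and step: "\<And>n. p (Suc n) \<le> \<mu> * p n + c * \<alpha> n"
    and sq: "summable (\<lambda>n. (\<alpha> n)\<^sup>2)"
  shows "summable (\<lambda>n. (p n)\<^sup>2)"
proof (rule summable_of_contracting_recursion[OF _ \<mu>, where r = "\<lambda>n. c\<^sup>2 / (1 - \<mu>) * (\<alpha> n)\<^sup>2"])
  fix n
  have "(p (Suc n))\<^sup>2 \<le> (\<mu> * p n + c * \<alpha> n)\<^sup>2"
    by (intro power_mono step p0)
  \<comment> \<open>Convexity of the square with weights \<open>\<mu>\<close> and
    \<open>1 - \<mu>\<close> at the points \<open>p n\<close> and
    \<open>c * \<alpha> n / (1 - \<mu>)\<close>.\<close>
  also have "\<dots> \<le> \<mu> * (p n)\<^sup>2 + c\<^sup>2 / (1 - \<mu>) * (\<alpha> n)\<^sup>2"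
  proof -
    have "0 \<le> \<mu> / (1 - \<mu>) * ((1 - \<mu>) * p n - c * \<alpha> n)\<^sup>2" using \<mu> by simp
    also have "\<dots> = \<mu> * (p n)\<^sup>2 + c\<^sup>2 / (1 - \<mu>) * (\<alpha> n)\<^sup>2 - (\<mu> * p n + c * \<alpha> n)\<^sup>2"
      using \<mu> by (simp add: divide_simps) (simp add: power2_eq_square algebra_simps)
    finally show ?thesis by simp
  qed
  finally show "(p (Suc n))\<^sup>2 \<le> \<mu> * (p n)\<^sup>2 + c\<^sup>2 / (1 - \<mu>) * (\<alpha> n)\<^sup>2" .
qed (use \<mu> sq in \<open>auto intro: summable_mult\<close>)

lemma bounded_of_contracting_recursion:
  fixes p \<alpha> :: "nat \<Rightarrow> real"
  assumes p0: "\<And>n. 0 \<le> p n" and \<mu>: "0 \<le> \<mu>" "\<mu> < 1"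
    and c: "0 \<le> c" and \<alpha>0: "\<And>n. 0 \<le> \<alpha> n" and \<alpha>: "\<alpha> \<longlonglongrightarrow> 0"
    and step: "\<And>n. p (Suc n) \<le> \<mu> * p n + c * \<alpha> n * (1 + p n)"
  shows "\<exists>C\<ge>0. \<forall>n. p n \<le> C"
proof -
  \<comment> \<open>Half of the contraction margin is reserved for the feedback: once
    \<open>c * \<alpha> n \<le> \<nu>\<close>, a step is bounded by
    \<open>(1 - \<nu>) * p n + \<nu>\<close>.\<close>
  define \<nu> where "\<nu> = (1 - \<mu>) / 2"
  have \<nu>: "0 < \<nu>" "\<mu> + \<nu> = 1 - \<nu>" using \<mu> by (auto simp: \<nu>_def field_simps)
  have "(\<lambda>n. c * \<alpha> n) \<longlonglongrightarrow> 0" using tendsto_mult_right_zero[OF \<alpha>] by simp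
  then have "\<forall>\<^sub>F n in sequentially. c * \<alpha> n < \<nu>" using \<nu>(1) by (rule order_tendstoD)
  then obtain m where m: "\<And>n. n \<ge> m \<Longrightarrow> c * \<alpha> n \<le> \<nu>"
    by (auto simp: eventually_sequentially intro: less_imp_le)
  \<comment> \<open>The element 1 makes the bound invariant:
    \<open>(1 - \<nu>) * C + \<nu> \<le> C\<close> requires \<open>1 \<le> C\<close>.\<close>
  define C where "C = Max (insert 1 (p ` {..m}))"
  have C: "1 \<le> C" "\<And>n. n \<le> m \<Longrightarrow> p n \<le> C"
    unfolding C_def by (rule Max_ge; simp)+
  have "p n \<le> C" for n
  proof (induction n)
    case (Suc n)
    show ?case
    proof (cases "Suc n \<le> m")
      case False
      then have "p (Suc n) \<le> \<mu> * p n + \<nu> * (1 + p n)"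
        using step[of n] mult_right_mono[OF m[of n], of "1 + p n"] p0[of n] by linarith
      also have "\<dots> = (1 - \<nu>) * p n + \<nu>" by (simp add: \<nu>(2)[symmetric] algebra_simps)
      also have "\<dots> \<le> (1 - \<nu>) * C + \<nu> * C"
        using Suc C(1) \<nu> \<mu> by (intro add_mono mult_left_mono) auto
      finally show ?thesis by (simp add: algebra_simps)
    qed (use C in auto)
  qed (use C in auto)
  with C(1) show ?thesis by (intro exI[of _ C]) auto
qed

text \<open>Divergence of the sum of \<alpha> forces \<open>b\<close> below every threshold
  infinitely often. A later climb to twice the threshold stays above it after the last visit below,
  and there the summable energy dominates the increments, so late climbs are too short. Only upward
  moves need a bound.\<close>

lemma tendsto_zero_of_slow_increase:
  fixes b \<alpha> :: "nat \<Rightarrow> real"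
  assumes b0: "\<And>n. 0 \<le> b n" and \<alpha>0: "\<And>n. 0 \<le> \<alpha> n" and \<alpha>: "\<alpha> \<longlonglongrightarrow> 0" "\<not> summable \<alpha>"
    and C: "0 \<le> C" and step: "\<And>n. b (Suc n) \<le> b n + C * \<alpha> n"
    and sm: "summable (\<lambda>n. \<alpha> n * (b n)\<^sup>2)"
  shows "b \<longlonglongrightarrow> 0"
proof (rule LIMSEQ_I)
  fix e :: real assume "0 < e"
  define \<delta> where "\<delta> = e / 2"
  have \<delta>: "0 < \<delta>" using \<open>0 < e\<close> by (simp add: \<delta>_def)
  have small: "\<exists>n\<ge>m. b n < \<delta>" for m
  proof (rule ccontr)
    assume "\<not> ?thesis"
    then have ge: "\<And>n. n \<ge> m \<Longrightarrow> \<delta> \<le> b n" by (auto simp: not_less)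
    have "summable \<alpha>"
    proof (rule summable_comparison_test_ev)
      show "summable (\<lambda>n. \<alpha> n * (b n)\<^sup>2 / \<delta>\<^sup>2)" by (rule summable_divide[OF sm])
      show "\<forall>\<^sub>F n in sequentially. norm (\<alpha> n) \<le> \<alpha> n * (b n)\<^sup>2 / \<delta>\<^sup>2"
        unfolding eventually_sequentially
      proof (intro exI[of _ m] allI impI)
        fix n assume "m \<le> n"
        then have "\<delta>\<^sup>2 \<le> (b n)\<^sup>2" using ge[of n] \<delta> by (intro power_mono) auto
        then have "\<alpha> n * \<delta>\<^sup>2 \<le> \<alpha> n * (b n)\<^sup>2" by (intro mult_left_mono \<alpha>0)
        then show "norm (\<alpha> n) \<le> \<alpha> n * (b n)\<^sup>2 / \<delta>\<^sup>2" using \<delta> \<alpha>0[of n] by (simp add: field_simps)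
      qed
    qed
    with \<alpha> show False by simp
  qed
  have "(\<lambda>n. C * \<alpha> n) \<longlonglongrightarrow> 0" using tendsto_mult_right_zero[OF \<alpha>(1)] by simp
  then have "\<forall>\<^sub>F n in sequentially. C * \<alpha> n < \<delta> / 2" using \<delta> by (intro order_tendstoD) auto
  then obtain m1 where m1: "\<And>n. n \<ge> m1 \<Longrightarrow> C * \<alpha> n < \<delta> / 2" by (auto simp: eventually_sequentially)
  have smC: "summable (\<lambda>n. C / \<delta>\<^sup>2 * (\<alpha> n * (b n)\<^sup>2))" by (rule summable_mult[OF sm])
  from summable_partial_sum_bound[OF this, of "\<delta> / 2"] \<delta>
  obtain m2 where m2: "\<And>m n. m \<ge> m2 \<Longrightarrow> norm (\<Sum>k=m..n. C / \<delta>\<^sup>2 * (\<alpha> k * (b k)\<^sup>2)) < \<delta> / 2" by auto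
  obtain s where s: "s \<ge> max m1 m2" "b s < \<delta>" using small by blast
  have "b n < e" if "n \<ge> s" for n
  proof (rule ccontr)
    assume "\<not> b n < e"
    then have bn: "b n \<ge> 2 * \<delta>" by (simp add: \<delta>_def)
    \<comment> \<open>The last visit below \<open>\<delta>\<close> up to time \<open>n\<close>; it
      does not precede \<open>s\<close>, so the tail estimates hold on the whole climb.\<close>
    define t where "t = Max {k. k \<le> n \<and> b k < \<delta>}"
    have fin: "finite {k. k \<le> n \<and> b k < \<delta>}" by simp
    have sin: "s \<in> {k. k \<le> n \<and> b k < \<delta>}" using that s by auto
    have t: "t \<le> n" "b t < \<delta>" "s \<le> t"
      using Max_in[OF fin] Max_ge[OF fin sin] sin unfolding t_def by blast+
    have above: "\<delta> \<le> b k" if "t < k" "k \<le> n" for k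
    proof (rule ccontr)
      assume "\<not> \<delta> \<le> b k"
      then have "k \<le> t" unfolding t_def using that by (intro Max_ge fin) simp
      then show False using that by simp
    qed
    have "t \<noteq> n"
    proof
      assume "t = n"
      with t(2) have "b n < \<delta>" by simp
      then show False using bn \<delta> by linarith
    qed
    then have "t < n" using t(1) by simp
    have tele: "b k \<le> b (Suc t) + (\<Sum>j=Suc t..<k. C * \<alpha> j)" if "Suc t \<le> k" for k
      using that
    proof (induction k rule: dec_induct)
      case (step k) then show ?case using assms(6)[of k] by simp
    qed simp
    \<comment> \<open>Above \<open>\<delta>\<close> the factor
      \<open>(b j)\<^sup>2 / \<delta>\<^sup>2\<close> is at least 1, which turns increments into
      energy.\<close>
    have "(\<Sum>j=Suc t..<n. C * \<alpha> j) \<le> (\<Sum>j=Suc t..<n. C / \<delta>\<^sup>2 * (\<alpha> j * (b j)\<^sup>2))"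
    proof (rule sum_mono)
      fix j assume "j \<in> {Suc t..<n}"
      then have "\<delta>\<^sup>2 \<le> (b j)\<^sup>2" using above[of j] \<delta> by (intro power_mono) auto
      then have "C * \<alpha> j * \<delta>\<^sup>2 \<le> C * \<alpha> j * (b j)\<^sup>2" by (intro mult_left_mono mult_nonneg_nonneg \<alpha>0 C)
      then show "C * \<alpha> j \<le> C / \<delta>\<^sup>2 * (\<alpha> j * (b j)\<^sup>2)" using \<delta> by (simp add: field_simps)
    qed
    also have "\<dots> \<le> (\<Sum>j=Suc t..n. C / \<delta>\<^sup>2 * (\<alpha> j * (b j)\<^sup>2))"
      using C \<alpha>0 by (intro sum_mono2) auto
    also have "\<dots> < \<delta> / 2" using m2[of "Suc t" n] s t by auto
    finally have "b n < b (Suc t) + \<delta> / 2" using tele[of n] \<open>t < n\<close> by auto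
    also have "\<dots> < 2 * \<delta>" using step[of t] m1[of t] s t by auto
    finally show False using bn by simp
  qed
  then show "\<exists>no. \<forall>n\<ge>no. norm (b n - 0) < e" using b0 by auto
qed

lemma summable_of_descent:
  fixes u h s :: "nat \<Rightarrow> real"
  assumes h0: "\<And>n. 0 \<le> h n" and s0: "\<And>n. 0 \<le> s n" and s: "summable s"
    and lower: "\<And>n. m \<le> u n" and step: "\<And>n. u (Suc n) \<le> u n - h n + s n"
  shows "summable h" "u n \<le> u 0 + suminf s"
proof -
  have main: "u n + (\<Sum>k<n. h k) \<le> u 0 + (\<Sum>k<n. s k)" for n
  proof (induction n)
    case (Suc n) then show ?case using step[of n] by simp
  qed simp
  have le: "(\<Sum>k<n. s k) \<le> suminf s" for n using s s0 by (intro sum_le_suminf) auto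
  show "u n \<le> u 0 + suminf s" using main[of n] le[of n] sum_nonneg[of "{..<n}" h] h0 by auto
  show "summable h"
  proof (rule bounded_imp_summable[OF h0])
    show "(\<Sum>k\<le>n. h k) \<le> u 0 + suminf s - m" for n
      using main[of "Suc n"] le[of "Suc n"] lower[of "Suc n"] by (simp add: lessThan_Suc_atMost)
  qed
qed

lemma le_of_square_le: "c * r\<^sup>2 \<le> b * r \<Longrightarrow> 0 \<le> r \<Longrightarrow> 0 \<le> b \<Longrightarrow> c * r \<le> (b::real)"
  by (cases "r = 0") (auto simp: power2_eq_square mult.assoc[symmetric])

section \<open>Convex analysis\<close>

text \<open>Separates the epigraph of \<open>G\<close> from the strict hypograph over \<open>K\<close> of the affine
  function \<open>v \<mapsto> G p - c \<bullet> (v - p)\<close>; finiteness of \<open>G\<close> on the whole space rules out a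
  vertical hyperplane.\<close>

lemma subdiff_variational_inequality:
  fixes G :: "'a::euclidean_space \<Rightarrow> real"
  assumes G: "convex_on UNIV G" and K: "convex K" "p \<in> K"
    and min: "\<And>v. v \<in> K \<Longrightarrow> 0 \<le> c \<bullet> (v - p) + G v - G p"
  shows "\<exists>\<xi>\<in>subdiff G p. \<forall>v\<in>K. 0 \<le> (c + \<xi>) \<bullet> (v - p)"
proof -
  define T where "T = {vt. fst vt \<in> K \<and> snd vt < G p - c \<bullet> (fst vt - p)}"
  have "convex T"
  proof (rule convexI)
    fix a b :: "'a \<times> real" and s t :: real
    assume ab: "a \<in> T" "b \<in> T" and st: "0 \<le> s" "0 \<le> t" "s + t = 1"
    have "s * snd a + t * snd b < s * (G p - c \<bullet> (fst a - p)) + t * (G p - c \<bullet> (fst b - p))"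
    proof (cases "s = 0")
      case False
      then have "s * snd a < s * (G p - c \<bullet> (fst a - p))" using ab st by (auto simp: T_def)
      moreover have "t * snd b \<le> t * (G p - c \<bullet> (fst b - p))"
        using ab st by (intro mult_left_mono) (auto simp: T_def)
      ultimately show ?thesis by linarith
    qed (use ab st in \<open>auto simp: T_def\<close>)
    also have "\<dots> = (s + t) * (G p + c \<bullet> p) - c \<bullet> (s *\<^sub>R fst a + t *\<^sub>R fst b)"
      by (simp add: algebra_simps inner_simps)
    also have "\<dots> = G p - c \<bullet> (s *\<^sub>R fst a + t *\<^sub>R fst b - p)"
      using st by (simp add: inner_simps)
    finally show "s *\<^sub>R a + t *\<^sub>R b \<in> T"
      using ab st K(1) by (auto simp: T_def convex_def)
  qed
  moreover have "(p, G p - 1) \<in> T" using K by (simp add: T_def)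
  moreover have "(p, G p) \<in> epigraph UNIV G" by (simp add: epigraph_def)
  moreover have "T \<inter> epigraph UNIV G = {}"
    using min by (force simp: T_def epigraph_def)
  ultimately obtain ab \<beta> where ab: "ab \<noteq> 0"
    and T: "\<And>q. q \<in> T \<Longrightarrow> ab \<bullet> q \<le> \<beta>" and epi: "\<And>q. q \<in> epigraph UNIV G \<Longrightarrow> \<beta> \<le> ab \<bullet> q"
    using separating_hyperplane_sets[of T "epigraph UNIV G"] convex_epigraphI[OF G] by blast
  obtain a b where [simp]: "ab = (a, b)" by (cases ab)
  have epi': "\<beta> \<le> a \<bullet> v + b * G v" for v using epi[of "(v, G v)"] by (simp add: epigraph_def)
  \<comment> \<open>\<open>T\<close> omits its upper boundary, so the bound there is reached as a
    limit from below.\<close>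
  have T': "a \<bullet> v + b * (G p - c \<bullet> (v - p)) \<le> \<beta>" if "v \<in> K" for v
  proof -
    have "((\<lambda>s. a \<bullet> v + b * (G p - c \<bullet> (v - p) - s)) \<longlongrightarrow> a \<bullet> v + b * (G p - c \<bullet> (v - p) - 0)) (at_right 0)"
      by (intro tendsto_intros)
    moreover have "\<forall>\<^sub>F s in at_right 0. a \<bullet> v + b * (G p - c \<bullet> (v - p) - s) \<le> \<beta>"
      using eventually_at_right_less[of 0]
    proof eventually_elim
      case (elim s)
      then show ?case using T[of "(v, G p - c \<bullet> (v - p) - s)"] that by (simp add: T_def)
    qed
    ultimately show ?thesis by (auto dest: tendsto_upperbound)
  qed
  have beta: "\<beta> = a \<bullet> p + b * G p" using epi'[of p] T'[OF K(2)] by simp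
  have "0 \<le> b" using epi[of "(p, G p + 1)"] by (simp add: epigraph_def beta algebra_simps)
  moreover have "b \<noteq> 0"
  proof
    assume "b = 0"
    \<comment> \<open>A vertical hyperplane is refuted at \<open>p - a\<close>, available because
      \<open>G\<close> is finite there.\<close>
    then have "0 \<le> a \<bullet> (- a)" using epi'[of "p - a"] by (simp add: beta inner_simps)
    then have "a = 0" by (simp add: power2_norm_eq_inner[symmetric])
    with ab \<open>b = 0\<close> show False by (simp add: zero_prod_def)
  qed
  ultimately have b: "0 < b" by simp
  show ?thesis
  proof (intro bexI ballI)
    show "- (1 / b) *\<^sub>R a \<in> subdiff G p"
      unfolding subdiff_def
    proof (clarsimp)
      fix v
      show "G p - a \<bullet> (v - p) / b \<le> G v"
        using epi'[of v] b by (simp add: beta field_simps inner_simps)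
    qed
    fix v assume "v \<in> K"
    then show "0 \<le> (c + - (1 / b) *\<^sub>R a) \<bullet> (v - p)"
    proof -
      have "0 \<le> (b * (c \<bullet> (v - p)) - a \<bullet> (v - p)) / b"
        using T'[OF \<open>v \<in> K\<close>] b by (intro divide_nonneg_pos) (simp_all add: beta inner_simps algebra_simps)
      then show ?thesis using b by (simp add: inner_simps diff_divide_distrib)
    qed
  qed
qed

lemma convex_lipschitz_of_subdiff_bound:
  fixes G :: "'a::euclidean_space \<Rightarrow> real"
  assumes G: "convex_on UNIV G" and bd: "\<And>u \<xi>. u \<in> K \<Longrightarrow> \<xi> \<in> subdiff G u \<Longrightarrow> norm \<xi> \<le> M"
    and u: "u \<in> K"
  shows "G u - G v \<le> M * norm (u - v)" "0 \<le> M"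
proof -
  \<comment> \<open>With the singleton \<open>{u}\<close> as constraint set the variational lemma
    yields mere existence of a subgradient.\<close>
  obtain \<xi> where \<xi>: "\<xi> \<in> subdiff G u"
    using subdiff_variational_inequality[OF G, of "{u}" u 0] by auto
  have "G u - G v \<le> \<xi> \<bullet> (u - v)" using \<xi> by (auto simp: subdiff_def inner_diff_right algebra_simps dest: spec[of _ v])
  also have "\<dots> \<le> norm \<xi> * norm (u - v)" by (rule norm_cauchy_schwarz)
  also have "\<dots> \<le> M * norm (u - v)" by (intro mult_right_mono bd[OF u \<xi>]) simp
  finally show "G u - G v \<le> M * norm (u - v)" .
  show "0 \<le> M" using bd[OF u \<xi>] norm_ge_zero[of \<xi>] by linarith
qed

text \<open>Surrogates are differentiable only relative to \<open>K\<close>; convexity keeps the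
  segment towards \<open>v\<close> inside, which suffices for a one-sided directional
  derivative.\<close>

lemma has_derivative_within_convex_quotient:
  fixes h :: "'a::real_normed_vector \<Rightarrow> real"
  assumes h: "(h has_derivative D) (at u within K)" and K: "convex K" "u \<in> K" "v \<in> K"
  shows "((\<lambda>t. (h (u + t *\<^sub>R (v - u)) - h u) / t) \<longlongrightarrow> D (v - u)) (at_right 0)"
proof -
  have "(h has_derivative D) (at u within (\<lambda>t. u + t *\<^sub>R (v - u)) ` {0..1})"
  proof (rule has_derivative_subset[OF h], safe)
    fix t :: real assume "t \<in> {0..1}"
    then have "(1 - t) *\<^sub>R u + t *\<^sub>R v \<in> K" using K by (auto simp: convex_alt)
    then show "u + t *\<^sub>R (v - u) \<in> K" by (simp add: algebra_simps)
  qed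
  then have "((\<lambda>t. h (u + t *\<^sub>R (v - u))) has_derivative (\<lambda>t. D (t *\<^sub>R (v - u)))) (at 0 within {0..1::real})"
    by (intro has_derivative_in_compose[where f = "\<lambda>t. u + t *\<^sub>R (v - u)" and g = h])
       (auto intro!: derivative_eq_intros)
  moreover have "bounded_linear D" using h by (rule has_derivative_bounded_linear)
  ultimately have "((\<lambda>t. h (u + t *\<^sub>R (v - u))) has_field_derivative D (v - u)) (at 0 within {0..1::real})"
    by (simp add: has_field_derivative_def linear_simps mult.commute[of _ "D (v - u)"] mult_commute_abs)
  then have "((\<lambda>t. (h (u + t *\<^sub>R (v - u)) - h u) / t) \<longlongrightarrow> D (v - u)) (at 0 within {0..1})"
    by (simp add: has_field_derivative_iff)
  moreover have "at (0::real) within {0..1} = at_right 0"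
    by (rule at_within_Icc_at_right) simp
  ultimately show ?thesis by simp
qed

lemma strongly_convex_on_gradient:
  fixes h :: "'a::real_inner \<Rightarrow> real"
  assumes sc: "strongly_convex_on K \<tau> h"
    and h: "(h has_derivative (\<lambda>d. g \<bullet> d)) (at u within K)" and uv: "u \<in> K" "v \<in> K"
  shows "h u + g \<bullet> (v - u) + \<tau> / 2 * (norm (v - u))\<^sup>2 \<le> h v"
proof -
  have K: "convex K" using sc by (simp add: strongly_convex_on_def)
  have lim: "((\<lambda>t. (h (u + t *\<^sub>R (v - u)) - h u) / t) \<longlongrightarrow> g \<bullet> (v - u)) (at_right 0)"
    by (rule has_derivative_within_convex_quotient[OF h K uv])
  have "((\<lambda>t. h v - h u - \<tau> / 2 * (1 - t) * (norm (v - u))\<^sup>2) \<longlongrightarrow>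
      h v - h u - \<tau> / 2 * (1 - 0) * (norm (v - u))\<^sup>2) (at_right 0)"
    by (intro tendsto_intros)
  moreover have "\<forall>\<^sub>F t in at_right 0. (h (u + t *\<^sub>R (v - u)) - h u) / t
      \<le> h v - h u - \<tau> / 2 * (1 - t) * (norm (v - u))\<^sup>2"
    using eventually_at_right_real[of 0 1, OF zero_less_one]
  proof eventually_elim
    case (elim t)
    then have "h (t *\<^sub>R v + (1 - t) *\<^sub>R u) \<le> t * h v + (1 - t) * h u - \<tau> / 2 * t * (1 - t) * (norm (v - u))\<^sup>2"
      using sc uv by (auto simp: strongly_convex_on_def)
    moreover have "t *\<^sub>R v + (1 - t) *\<^sub>R u = u + t *\<^sub>R (v - u)" by (simp add: algebra_simps)
    ultimately show ?case using elim by (simp add: field_simps)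
  qed
  ultimately show ?thesis using tendsto_le[OF _ _ lim] by fastforce
qed

text \<open>Add the first-order inequalities at \<open>u\<close> and at \<open>v\<close>; the two
  halves of \<open>\<tau>\<close> combine.\<close>

lemma strongly_convex_on_monotone:
  fixes h :: "'a::real_inner \<Rightarrow> real"
  assumes sc: "strongly_convex_on K \<tau> h"
    and h: "\<And>u. u \<in> K \<Longrightarrow> (h has_derivative (\<lambda>d. g u \<bullet> d)) (at u within K)"
    and uv: "u \<in> K" "v \<in> K"
  shows "\<tau> * (norm (v - u))\<^sup>2 \<le> (g v - g u) \<bullet> (v - u)"
  using strongly_convex_on_gradient[OF sc h[OF uv(1)] uv]
    strongly_convex_on_gradient[OF sc h[OF uv(2)] uv(2) uv(1)]
  by (simp add: inner_diff_left inner_diff_right norm_minus_commute algebra_simps)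

text \<open>Compare with a point at fraction \<open>t\<close> of the segment: convexity handles
  \<open>G\<close>, differentiability handles \<open>h\<close>. \<open>G\<close> is kept as a
  difference of values, a form that passes to the limit without selecting subgradients along the
  way.\<close>

lemma composite_minimizer_variational_inequality:
  fixes h G :: "'a::real_inner \<Rightarrow> real"
  assumes K: "convex K" and p: "p \<in> K"
    and h: "(h has_derivative (\<lambda>d. g \<bullet> d)) (at p within K)"
    and G: "convex_on UNIV G"
    and min: "\<And>v. v \<in> K \<Longrightarrow> h p + q \<bullet> (p - r) + G p \<le> h v + q \<bullet> (v - r) + G v"
    and v: "v \<in> K"
  shows "0 \<le> (g + q) \<bullet> (v - p) + G v - G p"
proof -
  have lim: "((\<lambda>t. (h (p + t *\<^sub>R (v - p)) - h p) / t) \<longlongrightarrow> g \<bullet> (v - p)) (at_right 0)"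
    by (rule has_derivative_within_convex_quotient[OF h K p v])
  have "\<forall>\<^sub>F t in at_right 0. G p - G v - q \<bullet> (v - p) \<le> (h (p + t *\<^sub>R (v - p)) - h p) / t"
    using eventually_at_right_real[of 0 1, OF zero_less_one]
  proof eventually_elim
    case (elim t)
    have eq: "p + t *\<^sub>R (v - p) = (1 - t) *\<^sub>R p + t *\<^sub>R v" by (simp add: algebra_simps)
    have "(1 - t) *\<^sub>R p + t *\<^sub>R v \<in> K" using K p v elim by (auto simp: convex_alt)
    then have "h p + q \<bullet> (p - r) + G p
        \<le> h (p + t *\<^sub>R (v - p)) + q \<bullet> (p + t *\<^sub>R (v - p) - r) + G (p + t *\<^sub>R (v - p))"
      using min eq by simp
    moreover have "G (p + t *\<^sub>R (v - p)) \<le> (1 - t) * G p + t * G v"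
      using convex_onD[OF G, of t p v] elim eq by auto
    ultimately show ?case using elim by (simp add: field_simps inner_simps)
  qed
  from tendsto_lowerbound[OF lim this] show ?thesis by (simp add: inner_simps)
qed

text \<open>The mean value theorem with the crude bound \<open>t \<le> 1\<close> gives
  \<open>M\<close> in place of the sharp \<open>M / 2\<close>; the term only has to be summable
  later.\<close>

lemma descent_lemma:
  fixes F :: "'a::real_inner \<Rightarrow> real"
  assumes K: "convex K" and ab: "a \<in> K" "b \<in> K"
    and F: "\<And>u. u \<in> K \<Longrightarrow> (F has_derivative (\<lambda>h. g u \<bullet> h)) (at u)"
    and g: "M-lipschitz_on K g"
  shows "F b \<le> F a + g a \<bullet> (b - a) + M * (norm (b - a))\<^sup>2"
proof -
  have seg: "a + t *\<^sub>R (b - a) \<in> K" if "t \<in> {0..1}" for t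
  proof -
    have "(1 - t) *\<^sub>R a + t *\<^sub>R b \<in> K" using that K ab by (auto simp: convex_alt)
    then show ?thesis by (simp add: algebra_simps)
  qed
  have "((\<lambda>t. F (a + t *\<^sub>R (b - a))) has_derivative (\<lambda>s. g (a + t *\<^sub>R (b - a)) \<bullet> (s *\<^sub>R (b - a)))) (at t within {0..1})"
    if "t \<in> {0..1}" for t
    by (rule has_derivative_compose[where f = "\<lambda>t. a + t *\<^sub>R (b - a)", OF _ F[OF seg[OF that]]])
       (auto intro!: derivative_eq_intros)
  then obtain t where t: "t \<in> {0..1}" "F b - F a = g (a + t *\<^sub>R (b - a)) \<bullet> (b - a)"
    using mvt_very_simple[of 0 1 "\<lambda>t. F (a + t *\<^sub>R (b - a))"
        "\<lambda>t s. g (a + t *\<^sub>R (b - a)) \<bullet> (s *\<^sub>R (b - a))"] by auto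
  have M: "0 \<le> M" using g by (rule lipschitz_on_nonneg)
  have "(g (a + t *\<^sub>R (b - a)) - g a) \<bullet> (b - a) \<le> norm (g (a + t *\<^sub>R (b - a)) - g a) * norm (b - a)"
    by (rule norm_cauchy_schwarz)
  also have "norm (g (a + t *\<^sub>R (b - a)) - g a) \<le> M * norm (t *\<^sub>R (b - a))"
    using lipschitz_onD[OF g seg[OF t(1)] ab(1)] by (simp add: dist_norm)
  also have "\<dots> \<le> M * norm (b - a)"
    using t M by (intro mult_left_mono) (auto simp: mult_left_le_one_le)
  finally show ?thesis using t(2)
    by (simp add: inner_diff_left power2_eq_square mult.assoc mult_right_mono)
qed

lemma coercive_on_bounded_below:
  fixes U :: "'a::euclidean_space \<Rightarrow> real"
  assumes "closed K" "continuous_on K U" "coercive_on K U"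
  obtains m where "\<And>u. u \<in> K \<Longrightarrow> m \<le> U u"
proof -
  obtain R where R: "\<And>u. u \<in> K \<Longrightarrow> R \<le> norm u \<Longrightarrow> 0 \<le> U u"
    using assms(3) unfolding coercive_on_def by meson
  have "compact (K \<inter> cball 0 R)" using assms(1) by (simp add: closed_Int_compact)
  then have "compact (U ` (K \<inter> cball 0 R))"
    using assms(2) by (intro compact_continuous_image) (auto intro: continuous_on_subset)
  then have "bdd_below (U ` (K \<inter> cball 0 R))"
    by (intro bounded_imp_bdd_below compact_imp_bounded)
  then obtain m where "\<And>u. u \<in> K \<Longrightarrow> norm u \<le> R \<Longrightarrow> m \<le> U u"
    by (force simp: bdd_below_def)
  then show thesis using R by (intro that[of "min m 0"]) (meson le_cases min.coboundedI1 min.coboundedI2)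
qed

section \<open>Consensus over jointly connected digraphs\<close>

text \<open>The l1 norm is used because column sums equal to one make mixing nonexpansive in it.
  Agent families are functions on all naturals, of which only indices below \<open>I\<close>
  count.\<close>

definition total_norm :: "nat \<Rightarrow> (nat \<Rightarrow> 'a::real_normed_vector) \<Rightarrow> real" where
  "total_norm I v = (\<Sum>i<I. norm (v i))"

definition mean :: "nat \<Rightarrow> (nat \<Rightarrow> 'a::real_vector) \<Rightarrow> 'a" where
  "mean I v = (1 / of_nat I) *\<^sub>R (\<Sum>i<I. v i)"

lemma total_norm_nonneg: "0 \<le> total_norm I v"
  by (simp add: total_norm_def sum_nonneg)

lemma norm_le_total_norm: "i < I \<Longrightarrow> norm (v i) \<le> total_norm I v"
  unfolding total_norm_def by (rule member_le_sum) auto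

lemma total_norm_triangle: "total_norm I (\<lambda>i. u i + v i) \<le> total_norm I u + total_norm I v"
  by (simp add: total_norm_def sum.distrib[symmetric] sum_mono norm_triangle_ineq)

lemma total_norm_triangle_diff: "total_norm I (\<lambda>i. u i - v i) \<le> total_norm I u + total_norm I v"
  by (simp add: total_norm_def sum.distrib[symmetric] sum_mono norm_triangle_ineq4)

lemma total_norm_scaleR: "total_norm I (\<lambda>i. c *\<^sub>R v i) = \<bar>c\<bar> * total_norm I v"
  by (simp add: total_norm_def sum_distrib_left)

lemma total_norm_cong: "(\<And>i. i < I \<Longrightarrow> u i = v i) \<Longrightarrow> total_norm I u = total_norm I v"
  by (simp add: total_norm_def)

lemma sum_eq_scaleR_mean: "I \<ge> 1 \<Longrightarrow> (\<Sum>i<I. v i) = of_nat I *\<^sub>R mean I v"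
  by (simp add: mean_def)

lemma sum_diff_mean: "I \<ge> 1 \<Longrightarrow> (\<Sum>i<I. v i - mean I v) = 0"
  by (simp add: sum_subtractf sum_eq_scaleR_mean sum_constant_scaleR)

lemma norm_mean_le: "norm (mean I v) \<le> total_norm I v / I"
  unfolding mean_def total_norm_def by (simp add: norm_sum divide_right_mono)

lemma total_norm_diff_mean: "I \<ge> 1 \<Longrightarrow> total_norm I (\<lambda>i. v i - mean I v) \<le> 2 * total_norm I v"
  using total_norm_triangle_diff[of I v "\<lambda>_. mean I v"] norm_mean_le[of I v]
  by (simp add: total_norm_def field_simps)

section \<open>Doubly stochastic mixing and its transition coefficients\<close>

locale gossip =
  fixes I :: nat and w :: "nat \<Rightarrow> nat \<Rightarrow> nat \<Rightarrow> real"
  assumes I_pos: "I \<ge> 1"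
    and w_nonneg: "\<And>n i j. 0 \<le> w n i j"
    and w_row: "\<And>n i. i < I \<Longrightarrow> (\<Sum>j<I. w n i j) = 1"
    and w_col: "\<And>n j. j < I \<Longrightarrow> (\<Sum>i<I. w n i j) = 1"
begin

definition mix :: "nat \<Rightarrow> (nat \<Rightarrow> 'a::real_normed_vector) \<Rightarrow> nat \<Rightarrow> 'a" where
  "mix n v i = (\<Sum>j<I. w n i j *\<^sub>R v j)"

lemma sum_mix: "(\<Sum>i<I. mix n v i) = (\<Sum>j<I. v j)"
proof -
  have "(\<Sum>i<I. mix n v i) = (\<Sum>j<I. (\<Sum>i<I. w n i j) *\<^sub>R v j)"
    unfolding mix_def by (subst sum.swap) (simp add: scaleR_left.sum)
  then show ?thesis by (simp add: w_col)
qed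

lemma mix_add: "mix n (\<lambda>j. u j + v j) i = mix n u i + mix n v i"
  by (simp add: mix_def scaleR_right_distrib sum.distrib)

lemma mix_scaleR: "mix n (\<lambda>j. c *\<^sub>R v j) i = c *\<^sub>R mix n v i"
  by (simp add: mix_def scaleR_sum_right mult.commute)

lemma mix_diff_const: "i < I \<Longrightarrow> mix n (\<lambda>j. v j - c) i = mix n v i - c"
  by (simp add: mix_def scaleR_right_diff_distrib sum_subtractf scaleR_left.sum[symmetric] w_row)

lemma total_norm_mix: "total_norm I (mix n v) \<le> total_norm I v"
proof -
  have "total_norm I (mix n v) \<le> (\<Sum>i<I. \<Sum>j<I. w n i j * norm (v j))"
    unfolding total_norm_def mix_def
    by (intro sum_mono order_trans[OF norm_sum]) (simp add: w_nonneg)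
  also have "\<dots> = (\<Sum>j<I. (\<Sum>i<I. w n i j) * norm (v j))"
    by (subst sum.swap) (simp add: sum_distrib_right)
  also have "\<dots> = total_norm I v" by (simp add: w_col total_norm_def)
  finally show ?thesis .
qed

text \<open>Mixing fixes constants, so the mean may be subtracted first; nonexpansiveness then gives
  the factor 2.\<close>

lemma total_norm_mix_diff:
  "total_norm I (\<lambda>i. mix n v i - v i) \<le> 2 * total_norm I (\<lambda>i. v i - mean I v)"
proof -
  have "total_norm I (\<lambda>i. mix n v i - v i)
      = total_norm I (\<lambda>i. mix n (\<lambda>j. v j - mean I v) i - (v i - mean I v))"
    by (rule total_norm_cong) (simp add: mix_diff_const)
  also have "\<dots> \<le> 2 * total_norm I (\<lambda>i. v i - mean I v)"
    using total_norm_triangle_diff[of I "mix n (\<lambda>j. v j - mean I v)" "\<lambda>i. v i - mean I v"]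
      total_norm_mix[of n "\<lambda>j. v j - mean I v"] by simp
  finally show ?thesis .
qed

primrec evolve :: "nat \<Rightarrow> nat \<Rightarrow> (nat \<Rightarrow> 'a::real_normed_vector) \<Rightarrow> nat \<Rightarrow> 'a" where
  "evolve n 0 v = v"
| "evolve n (Suc m) v = mix (n + m) (evolve n m v)"

lemma evolve_Suc_left: "evolve n (Suc m) v = evolve (Suc n) m (mix n v)"
  by (induction m) auto

lemma evolve_plus: "evolve n (k + m) v = evolve (n + k) m (evolve n k v)"
  by (induction m) (auto simp: add.assoc)

lemma evolve_add: "evolve n m (\<lambda>j. u j + v j) i = evolve n m u i + evolve n m v i"
proof (induction m arbitrary: i)
  case (Suc m)
  have "evolve n m (\<lambda>j. u j + v j) = (\<lambda>i. evolve n m u i + evolve n m v i)" using Suc by auto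
  then show ?case by (simp add: mix_add)
qed simp

lemma sum_evolve: "(\<Sum>i<I. evolve n m v i) = (\<Sum>i<I. v i)"
  by (induction m) (auto simp: sum_mix)

lemma total_norm_evolve: "total_norm I (evolve n m v) \<le> total_norm I v"
  by (induction m) (auto intro: order_trans[OF total_norm_mix])

text \<open>\<open>evolve n m (unit_vec j) i\<close> is entry \<open>(i, j)\<close> of the product
  of the \<open>m\<close> weight matrices from time \<open>n\<close> on; it stands in for matrix
  products.\<close>

definition unit_vec :: "nat \<Rightarrow> nat \<Rightarrow> real" where
  "unit_vec j = (\<lambda>i. if i = j then 1 else 0)"

lemma evolve_unit_nonneg: "0 \<le> evolve n m (unit_vec j) i"
  by (induction m arbitrary: i) (auto simp: unit_vec_def mix_def w_nonneg intro!: sum_nonneg)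

lemma evolve_unit_col: "j < I \<Longrightarrow> (\<Sum>i<I. evolve n m (unit_vec j) i) = 1"
  by (simp add: sum_evolve) (simp add: unit_vec_def)

lemma evolve_expand:
  assumes "i < I"
  shows "evolve n m v i = (\<Sum>j<I. evolve n m (unit_vec j) i *\<^sub>R v j)"
  using assms
proof (induction m arbitrary: i)
  case 0
  have "(\<Sum>j<I. evolve n 0 (unit_vec j) i *\<^sub>R v j) = (\<Sum>j<I. if i = j then v j else 0)"
    by (intro sum.cong) (auto simp: unit_vec_def)
  then show ?case using 0 by simp
next
  case (Suc m)
  have "evolve n (Suc m) v i = (\<Sum>l<I. w (n + m) i l *\<^sub>R (\<Sum>j<I. evolve n m (unit_vec j) l *\<^sub>R v j))"
    by (simp add: mix_def Suc.IH)
  also have "\<dots> = (\<Sum>j<I. \<Sum>l<I. (w (n + m) i l * evolve n m (unit_vec j) l) *\<^sub>R v j)"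
    by (subst sum.swap) (simp add: scaleR_sum_right)
  also have "\<dots> = (\<Sum>j<I. evolve n (Suc m) (unit_vec j) i *\<^sub>R v j)"
    by (simp add: mix_def scaleR_left.sum)
  finally show ?case .
qed

text \<open>Dobrushin-type contraction: on vectors of zero sum the uniform part \<open>\<delta>\<close> of the
  transition matrix acts as zero.\<close>

lemma total_norm_evolve_contraction:
  fixes v :: "nat \<Rightarrow> 'a::real_normed_vector"
  assumes zero: "(\<Sum>i<I. v i) = 0"
    and \<delta>: "0 \<le> \<delta>" "\<And>i j. i < I \<Longrightarrow> j < I \<Longrightarrow> \<delta> \<le> evolve n m (unit_vec j) i"
  shows "total_norm I (evolve n m v) \<le> (1 - \<delta>) * total_norm I v"
proof -
  let ?P = "\<lambda>i j. evolve n m (unit_vec j) i"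
  have "norm (evolve n m v i) \<le> (\<Sum>j<I. (?P i j - \<delta>) * norm (v j))" if "i < I" for i
  proof -
    have "evolve n m v i = (\<Sum>j<I. (?P i j - \<delta>) *\<^sub>R v j)"
      using zero by (subst evolve_expand[OF that])
        (simp add: scaleR_left_diff_distrib sum_subtractf scaleR_sum_right[symmetric])
    then show ?thesis using \<delta> that by (auto intro!: sum_norm_le)
  qed
  then have "total_norm I (evolve n m v) \<le> (\<Sum>i<I. \<Sum>j<I. (?P i j - \<delta>) * norm (v j))"
    unfolding total_norm_def by (intro sum_mono) auto
  also have "\<dots> = (\<Sum>j<I. (\<Sum>i<I. ?P i j - \<delta>) * norm (v j))"
    by (subst sum.swap) (simp add: sum_distrib_right)
  also have "\<dots> = (1 - I * \<delta>) * total_norm I v"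
    by (simp add: sum_subtractf evolve_unit_col total_norm_def sum_distrib_left)
  also have "\<dots> \<le> (1 - \<delta>) * total_norm I v"
    using \<delta>(1) I_pos mult_right_mono[of 1 "real I" \<delta>] by (intro mult_right_mono total_norm_nonneg) auto
  finally show ?thesis .
qed

end

section \<open>Spreading of influence and geometric contraction\<close>

lemma rtrancl_leaves_set:
  assumes "(a, b) \<in> R\<^sup>*" "a \<in> S" "b \<notin> S"
  shows "\<exists>u v. (u, v) \<in> R \<and> u \<in> S \<and> v \<notin> S"
  using assms by (induction rule: rtrancl_induct) auto

locale connected_gossip = gossip +
  fixes E :: "nat \<Rightarrow> (nat \<times> nat) set" and B :: nat and \<theta>\<^sub>0 :: real
  assumes E_agents: "\<And>n. E n \<subseteq> {..<I} \<times> {..<I}"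
    and \<theta>\<^sub>0: "0 < \<theta>\<^sub>0" "\<theta>\<^sub>0 < 1"
    and w_edge: "\<And>n i j. (j, i) \<in> E n \<Longrightarrow> \<theta>\<^sub>0 \<le> w n i j"
    and w_self: "\<And>n i. \<theta>\<^sub>0 \<le> w n i i"
    and B_pos: "B > 0"
    and joint_connected: "\<And>k i j. i < I \<Longrightarrow> j < I \<Longrightarrow> (i, j) \<in> (\<Union>n\<in>{k*B..<(k+1)*B}. E n)\<^sup>*"
begin

text \<open>The threshold loses one factor \<open>\<theta>\<^sub>0\<close> per step, exactly the
  cost of passing an edge or a self-loop.\<close>

definition reached :: "nat \<Rightarrow> nat \<Rightarrow> nat \<Rightarrow> nat set" where
  "reached n j m = {i. i < I \<and> \<theta>\<^sub>0 ^ m \<le> evolve n m (unit_vec j) i}"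

lemma reached_step:
  assumes a: "a \<in> reached n j m" and b: "b < I" and w: "\<theta>\<^sub>0 \<le> w (n + m) b a"
  shows "b \<in> reached n j (Suc m)"
proof -
  have "\<theta>\<^sub>0 * \<theta>\<^sub>0 ^ m \<le> w (n + m) b a * evolve n m (unit_vec j) a"
    using a w \<theta>\<^sub>0 by (intro mult_mono) (auto simp: reached_def intro: evolve_unit_nonneg w_nonneg)
  also have "\<dots> \<le> (\<Sum>l<I. w (n + m) b l * evolve n m (unit_vec j) l)"
    using a by (intro member_le_sum) (auto simp: reached_def intro!: mult_nonneg_nonneg evolve_unit_nonneg w_nonneg)
  finally show ?thesis using b by (simp add: reached_def mix_def)
qed

lemma reached_mono: "m \<le> m' \<Longrightarrow> reached n j m \<subseteq> reached n j m'"
proof (induction m' rule: dec_induct)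
  case (step m')
  have "reached n j m' \<subseteq> reached n j (Suc m')"
    using reached_step[OF _ _ w_self] by (auto simp: reached_def)
  with step show ?case by blast
qed simp

text \<open>Self-weights keep reached agents reached until an edge leaving the set becomes active,
  and joint connectivity provides such an edge within the window. \<open>n \<le> k * B\<close> keeps
  the subtractions exact.\<close>

lemma reached_window:
  assumes j: "j < I" and n: "n \<le> k * B" and ne: "reached n j (k * B - n) \<noteq> {..<I}"
  shows "reached n j (k * B - n) \<subset> reached n j ((k + 1) * B - n)"
proof -
  let ?S = "reached n j (k * B - n)"
  have sub: "?S \<subseteq> {..<I}" by (auto simp: reached_def)
  then obtain b where b: "b < I" "b \<notin> ?S" using ne by auto
  have "j \<in> reached n j 0" using j by (simp add: reached_def unit_vec_def)
  then have "j \<in> ?S" using reached_mono[of 0 "k * B - n" n j] by blast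
  then obtain u v where uv: "(u, v) \<in> (\<Union>n\<in>{k*B..<(k+1)*B}. E n)" "u \<in> ?S" "v \<notin> ?S"
    using rtrancl_leaves_set[OF joint_connected[OF j b(1)]] b by blast
  then obtain t where t: "k * B \<le> t" "t < (k + 1) * B" "(u, v) \<in> E t" by auto
  have v: "v < I" using t E_agents by blast
  have "u \<in> reached n j (t - n)" using uv reached_mono[of "k * B - n" "t - n" n j] t by (auto intro: diff_le_mono)
  then have "v \<in> reached n j (Suc (t - n))"
    using v w_edge[OF t(3)] t n by (intro reached_step) auto
  then have "v \<in> reached n j ((k + 1) * B - n)"
    using reached_mono[of "Suc (t - n)" "(k + 1) * B - n" n j] t n by fastforce
  moreover have "?S \<subseteq> reached n j ((k + 1) * B - n)" by (intro reached_mono diff_le_mono) simp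
  ultimately show ?thesis using uv by blast
qed

lemma reached_all:
  assumes j: "j < I" shows "reached n j (I * B + B) = {..<I}"
proof -
  \<comment> \<open>The first window starting after \<open>n\<close>. Waiting for it takes at most
    \<open>B\<close> steps and \<open>I\<close> windows follow, whence
    \<open>I * B + B\<close>.\<close>
  define k where "k = n div B + 1"
  have div: "n div B * B \<le> n" "n < B + n div B * B"
    using B_pos by (simp_all add: dividend_less_div_times)
  have k: "n \<le> k * B" "k * B \<le> n + B" using div by (auto simp: k_def)
  have sub: "reached n j m \<subseteq> {..<I}" for m by (auto simp: reached_def)
  \<comment> \<open>Each full window adds an agent until all are reached.\<close>
  have "min I q \<le> card (reached n j ((k + q) * B - n))" for q
  proof (induction q)
    case (Suc q)
    let ?m = "(k + q) * B - n" and ?m' = "(k + q + 1) * B - n"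
    have "n \<le> (k + q) * B" using k by (simp add: add_mult_distrib)
    show ?case
    proof (cases "reached n j ?m = {..<I}")
      case True
      then have "reached n j ?m' = {..<I}"
        using sub[of ?m'] reached_mono[of ?m ?m' n j] by (auto intro: diff_le_mono)
      then show ?thesis by simp
    next
      case False
      then have "card (reached n j ?m) < card (reached n j ?m')"
        using reached_window[OF j \<open>n \<le> (k + q) * B\<close>] finite_subset[OF sub]
        by (intro psubset_card_mono) auto
      then show ?thesis using Suc by simp
    qed
  qed simp
  from this[of I] have "{..<I} = reached n j ((k + I) * B - n)"
    using sub by (intro card_seteq[symmetric]) (auto intro: finite_subset)
  also have "\<dots> \<subseteq> reached n j (I * B + B)" using k by (intro reached_mono) (simp add: add_mult_distrib)
  finally show ?thesis using sub by blast
qed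

lemma geometric_contraction:
  obtains \<rho> C where "0 < \<rho>" "\<rho> < 1" "0 < C"
    "\<And>n m (v :: nat \<Rightarrow> 'a::real_normed_vector). (\<Sum>i<I. v i) = 0 \<Longrightarrow>
       total_norm I (evolve n m v) \<le> C * \<rho> ^ m * total_norm I v"
proof -
  define T where "T = I * B + B"
  define \<delta> where "\<delta> = \<theta>\<^sub>0 ^ T"
  have T: "T > 0" using B_pos by (simp add: T_def)
  have \<delta>: "0 < \<delta>" "\<delta> < 1"
    using \<theta>\<^sub>0 T by (auto simp: \<delta>_def power_less_one_iff)
  \<comment> \<open>The root distributes the contraction of a block of length \<open>T\<close> over
    single steps; \<open>\<delta> < 1\<close> keeps it positive.\<close>
  define \<rho> where "\<rho> = root T (1 - \<delta>)"
  have \<rho>: "0 < \<rho>" "\<rho> < 1" "\<rho> ^ T = 1 - \<delta>" using \<delta> T by (auto simp: \<rho>_def)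
  have win: "total_norm I (evolve n T v) \<le> \<rho> ^ T * total_norm I v"
    if "(\<Sum>i<I. v i) = 0" for n and v :: "nat \<Rightarrow> 'a"
    unfolding \<rho>(3) using that \<delta>(1) reached_all[folded T_def]
    by (intro total_norm_evolve_contraction) (auto simp: reached_def \<delta>_def set_eq_iff)
  have wins: "total_norm I (evolve n (q * T) v) \<le> \<rho> ^ (q * T) * total_norm I v"
    if "(\<Sum>i<I. v i) = 0" for n q and v :: "nat \<Rightarrow> 'a"
  proof (induction q)
    case (Suc q)
    have "total_norm I (evolve n (q * T + T) v) \<le> \<rho> ^ T * total_norm I (evolve n (q * T) v)"
      unfolding evolve_plus by (rule win) (simp add: sum_evolve that)
    also have "\<dots> \<le> \<rho> ^ T * (\<rho> ^ (q * T) * total_norm I v)"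
      using \<rho>(1) Suc by (intro mult_left_mono zero_le_power) auto
    finally show ?case by (simp add: power_add mult.assoc add.commute)
  qed simp
  \<comment> \<open>The fewer than \<open>T\<close> leftover steps are merely nonexpansive; the
    prefactor \<open>1 / \<rho> ^ T\<close> compensates for them.\<close>
  have "total_norm I (evolve n m v) \<le> 1 / \<rho> ^ T * \<rho> ^ m * total_norm I v"
    if "(\<Sum>i<I. v i) = 0" for n m and v :: "nat \<Rightarrow> 'a"
  proof -
    let ?q = "m div T"
    have "m = ?q * T + m mod T" by simp
    then have "total_norm I (evolve n m v) \<le> total_norm I (evolve n (?q * T) v)"
      using evolve_plus[of n "?q * T" "m mod T" v] total_norm_evolve by metis
    also have "\<dots> \<le> \<rho> ^ (?q * T) * total_norm I v" by (rule wins[OF that])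
    also have "\<dots> \<le> 1 / \<rho> ^ T * \<rho> ^ m * total_norm I v"
    proof (rule mult_right_mono[OF _ total_norm_nonneg])
      have "m < ?q * T + T" using T by (simp add: dividend_less_div_times add.commute)
      then have "\<rho> ^ (?q * T + T) \<le> \<rho> ^ m" using \<rho> by (intro power_decreasing) auto
      then show "\<rho> ^ (?q * T) \<le> 1 / \<rho> ^ T * \<rho> ^ m" using \<rho>(1) by (simp add: power_add field_simps)
    qed
    finally show ?thesis .
  qed
  then show thesis using \<rho>(1,2) by (intro that[of \<rho> "1 / \<rho> ^ T"]) auto
qed

text \<open>The disagreement of a perturbed gossip process is dominated by a scalar sequence that
  contracts at every single step, although the disagreement itself need only contract over windows.\<close>

lemma perturbed_consensus:
  obtains \<rho> C where "0 < \<rho>" "\<rho> < 1" "0 < C"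
    "\<And>v e :: nat \<Rightarrow> nat \<Rightarrow> 'a::real_normed_vector. (\<And>n i. i < I \<Longrightarrow> v (Suc n) i = mix n (v n) i + e n i) \<Longrightarrow>
       \<exists>a. (\<forall>n. total_norm I (\<lambda>i. v n i - mean I (v n)) \<le> a n)
         \<and> (\<forall>n. a (Suc n) = \<rho> * a n + C * total_norm I (e n))"
proof -
  obtain \<rho> C where \<rho>: "0 < \<rho>" "\<rho> < 1" "0 < C"
    and contr: "\<And>n m (v :: nat \<Rightarrow> 'a). (\<Sum>i<I. v i) = 0 \<Longrightarrow>
       total_norm I (evolve n m v) \<le> C * \<rho> ^ m * total_norm I v"
    using geometric_contraction by metis
  have "\<exists>a. (\<forall>n. total_norm I (\<lambda>i. v n i - mean I (v n)) \<le> a n)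
         \<and> (\<forall>n. a (Suc n) = \<rho> * a n + 2 * C * total_norm I (e n))"
    if step: "\<And>n i. i < I \<Longrightarrow> v (Suc n) i = mix n (v n) i + e n i"
    for v e :: "nat \<Rightarrow> nat \<Rightarrow> 'a"
  proof -
    define u where "u n i = v n i - mean I (v n)" for n i
    define d where "d n i = e n i - mean I (e n)" for n i
    \<comment> \<open>\<open>C\<close> is charged when data enter, initially or through
      \<open>e n\<close>; the 2 accounts for removing the mean of \<open>e n\<close>.\<close>
    define a where "a = rec_nat (C * total_norm I (u 0)) (\<lambda>n r. \<rho> * r + 2 * C * total_norm I (e n))"
    have a: "a 0 = C * total_norm I (u 0)" "\<And>n. a (Suc n) = \<rho> * a n + 2 * C * total_norm I (e n)"
      by (simp_all add: a_def)
    have sum0: "(\<Sum>i<I. u n i) = 0" "(\<Sum>i<I. d n i) = 0" for n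
      using sum_diff_mean[OF I_pos] by (simp_all add: u_def d_def)
    have mean_Suc: "mean I (v (Suc n)) = mean I (v n) + mean I (e n)" for n
    proof -
      have "(\<Sum>i<I. v (Suc n) i) = (\<Sum>i<I. mix n (v n) i + e n i)" by (intro sum.cong) (auto simp: step)
      then show ?thesis by (simp add: mean_def sum.distrib sum_mix scaleR_right_distrib)
    qed
    have u_Suc: "u (Suc n) i = mix n (u n) i + d n i" if "i < I" for n i
      using that by (simp add: u_def[abs_def] d_def step mean_Suc mix_diff_const)
    \<comment> \<open>The recursion for \<open>u\<close> holds only below \<open>I\<close>, so
      evolutions can be exchanged only there.\<close>
    have cong: "evolve n m f i = evolve n m g i" if "\<And>j. j < I \<Longrightarrow> f j = g j" "i < I"
      for n m i and f g :: "nat \<Rightarrow> 'a"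
      using that by (simp add: evolve_expand[of i])
    \<comment> \<open>Bounding all further evolutions at once closes the induction: the prefactor
      \<open>C\<close> is paid once per perturbation, and every later step costs just
      \<open>\<rho>\<close>. The case \<open>m = 0\<close> is the claim.\<close>
    have "total_norm I (evolve n m (u n)) \<le> \<rho> ^ m * a n" for n m
    proof (induction n arbitrary: m)
      case 0
      show ?case using contr[OF sum0(1)[of 0], of 0 m] by (simp add: a mult_ac)
    next
      case (Suc n)
      have "total_norm I (evolve (Suc n) m (u (Suc n)))
          = total_norm I (\<lambda>i. evolve n (Suc m) (u n) i + evolve (Suc n) m (d n) i)"
        unfolding evolve_Suc_left evolve_add[symmetric]
        by (intro total_norm_cong cong) (auto simp: u_Suc)
      also have "\<dots> \<le> total_norm I (evolve n (Suc m) (u n)) + total_norm I (evolve (Suc n) m (d n))"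
        by (rule total_norm_triangle)
      also have "\<dots> \<le> \<rho> ^ Suc m * a n + C * \<rho> ^ m * (2 * total_norm I (e n))"
      proof (intro add_mono Suc.IH)
        have "total_norm I (evolve (Suc n) m (d n)) \<le> C * \<rho> ^ m * total_norm I (d n)"
          by (rule contr[OF sum0(2)])
        also have "\<dots> \<le> C * \<rho> ^ m * (2 * total_norm I (e n))"
          using \<rho> total_norm_diff_mean[OF I_pos, of "e n"] unfolding d_def
          by (intro mult_left_mono) auto
        finally show "total_norm I (evolve (Suc n) m (d n)) \<le> C * \<rho> ^ m * (2 * total_norm I (e n))" .
      qed
      also have "\<dots> = \<rho> ^ m * a (Suc n)" by (simp add: a algebra_simps)
      finally show ?case .
    qed
    from this[of _ 0] show ?thesis using a(2) unfolding u_def by (intro exI[of _ a]) auto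
  qed
  with \<rho> show thesis by (intro that[of \<rho> "2 * C"]) auto
qed

end

section \<open>The iteration\<close>

text \<open>The data of the theorem with constants made uniform in the agents, the surrogates reduced to
  strong monotonicity of their gradients, and the argmin replaced by its variational inequality.\<close>

locale next_iteration = connected_gossip I w E B \<theta>\<^sub>0
  for I w E B \<theta>\<^sub>0 +
  fixes K :: "'a::euclidean_space set"
    and f :: "nat \<Rightarrow> 'a \<Rightarrow> real" and gradf :: "nat \<Rightarrow> 'a \<Rightarrow> 'a" and G :: "'a \<Rightarrow> real"
    and gradft :: "nat \<Rightarrow> 'a \<Rightarrow> 'a \<Rightarrow> 'a"
    and Lip \<tau> LF LG \<epsilon>\<^sub>0 :: real
    and \<alpha> :: "nat \<Rightarrow> real" and \<epsilon> :: "nat \<Rightarrow> nat \<Rightarrow> real"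
    and x y xt xinx :: "nat \<Rightarrow> nat \<Rightarrow> 'a"
  assumes K: "closed K" "convex K"
    and f_deriv: "\<And>i u. i < I \<Longrightarrow> u \<in> K \<Longrightarrow> (f i has_derivative (\<lambda>h. gradf i u \<bullet> h)) (at u)"
    and gradf_lip: "\<And>i. i < I \<Longrightarrow> Lip-lipschitz_on K (gradf i)"
    and gradF_bdd: "\<And>u. u \<in> K \<Longrightarrow> norm (\<Sum>i<I. gradf i u) \<le> LF"
    and G_convex: "convex_on UNIV G"
    and G_lip: "\<And>u v. u \<in> K \<Longrightarrow> v \<in> K \<Longrightarrow> G u - G v \<le> LG * norm (u - v)"
    and LG: "0 \<le> LG"
    and coercive: "coercive_on K (\<lambda>u. (\<Sum>i<I. f i u) + G u)"
    and \<tau>: "0 < \<tau>"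
    and gradft_mono: "\<And>i u v r. i < I \<Longrightarrow> u \<in> K \<Longrightarrow> v \<in> K \<Longrightarrow> r \<in> K \<Longrightarrow>
          \<tau> * (norm (v - u))\<^sup>2 \<le> (gradft i v r - gradft i u r) \<bullet> (v - u)"
    and gradft_lip: "\<And>i u. i < I \<Longrightarrow> u \<in> K \<Longrightarrow> Lip-lipschitz_on K (gradft i u)"
    and gradft_diag: "\<And>i u. i < I \<Longrightarrow> u \<in> K \<Longrightarrow> gradft i u u = gradf i u"
    and init_x: "\<And>i. i < I \<Longrightarrow> x 0 i \<in> K"
    and init_y: "\<And>i. i < I \<Longrightarrow> y 0 i = gradf i (x 0 i)"
    and xt_in: "\<And>n i. i < I \<Longrightarrow> xt n i \<in> K"
    and xt_variational: "\<And>n i v. i < I \<Longrightarrow> x n i \<in> K \<Longrightarrow> v \<in> K \<Longrightarrow>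
          0 \<le> (gradft i (xt n i) (x n i) + (of_nat I *\<^sub>R y n i - gradf i (x n i))) \<bullet> (v - xt n i)
              + G v - G (xt n i)"
    and xinx_in: "\<And>n i. i < I \<Longrightarrow> xinx n i \<in> K"
    and xinx_err: "\<And>n i. i < I \<Longrightarrow> norm (xinx n i - xt n i) \<le> \<epsilon> n i"
    and x_upd: "\<And>n i. i < I \<Longrightarrow> x (Suc n) i = mix n (\<lambda>j. x n j + \<alpha> n *\<^sub>R (xinx n j - x n j)) i"
    and y_upd: "\<And>n i. i < I \<Longrightarrow>
          y (Suc n) i = mix n (y n) i + (gradf i (x (Suc n) i) - gradf i (x n i))"
    and \<epsilon>_le: "\<And>n i. i < I \<Longrightarrow> \<epsilon> n i \<le> \<epsilon>\<^sub>0"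
    and \<alpha>_range: "\<And>n. 0 < \<alpha> n" "\<And>n. \<alpha> n \<le> 1"
    and \<alpha>_div: "\<not> summable \<alpha>"
    and \<alpha>_sq: "summable (\<lambda>n. (\<alpha> n)\<^sup>2)"
    and \<alpha>_\<epsilon>: "\<And>i. i < I \<Longrightarrow> summable (\<lambda>n. \<alpha> n * \<epsilon> n i)"
begin

definition xb :: "nat \<Rightarrow> 'a" where "xb n = mean I (x n)"
definition yb :: "nat \<Rightarrow> 'a" where "yb n = mean I (y n)"
definition X :: "nat \<Rightarrow> real" where "X n = total_norm I (\<lambda>i. x n i - xb n)"
definition Y :: "nat \<Rightarrow> real" where "Y n = total_norm I (\<lambda>i. y n i - yb n)"
text \<open>\<open>D\<close> drives the iterates and includes the inexactness; \<open>d\<close>,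
  measured from the average with the exact minimizer, is the optimality gap.\<close>

definition D :: "nat \<Rightarrow> nat \<Rightarrow> 'a" where "D n i = xinx n i - x n i"
definition d :: "nat \<Rightarrow> nat \<Rightarrow> 'a" where "d n i = xt n i - xb n"
definition gradF :: "'a \<Rightarrow> 'a" where "gradF u = (\<Sum>i<I. gradf i u)"
text \<open>The vector called \<open>\<pi>\<close> in the theorem: an estimate of the gradient sum
  of the other agents, since \<open>I\<close> times \<open>y n i\<close> estimates the full
  gradient.\<close>

definition pr :: "nat \<Rightarrow> nat \<Rightarrow> 'a" where "pr n i = of_nat I *\<^sub>R y n i - gradf i (x n i)"

section \<open>Feasibility, gradient tracking and bounds on directions\<close>

lemma I_real: "1 \<le> real I"
  using I_pos by simp

lemma Lip_nonneg: "0 \<le> Lip"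
  using gradf_lip[of 0] I_pos by (auto intro: lipschitz_on_nonneg)

lemma \<epsilon>_nonneg: "i < I \<Longrightarrow> 0 \<le> \<epsilon> n i"
  using xinx_err[of i n] norm_ge_zero order_trans by blast

lemma \<epsilon>\<^sub>0_nonneg: "0 \<le> \<epsilon>\<^sub>0"
  using \<epsilon>_nonneg[of 0 0] \<epsilon>_le[of 0 0] I_pos by auto

lemma X_nonneg: "0 \<le> X n" and Y_nonneg: "0 \<le> Y n"
  by (simp_all add: X_def Y_def total_norm_nonneg)

lemma \<alpha>_nonneg: "0 \<le> \<alpha> n"
  using \<alpha>_range(1)[of n] by simp

lemma \<alpha>_tendsto: "\<alpha> \<longlonglongrightarrow> 0"
proof -
  have "(\<lambda>n. sqrt ((\<alpha> n)\<^sup>2)) \<longlonglongrightarrow> sqrt 0"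
    by (intro tendsto_real_sqrt summable_LIMSEQ_zero \<alpha>_sq)
  then show ?thesis by (simp add: \<alpha>_nonneg)
qed

lemma mix_in:
  assumes "i < I" "\<And>j. j < I \<Longrightarrow> v j \<in> K"
  shows "mix n v i \<in> K"
  unfolding mix_def using assms by (intro convex_sum K) (auto simp: w_row w_nonneg)

lemma x_in: "i < I \<Longrightarrow> x n i \<in> K"
proof (induction n arbitrary: i)
  case (Suc n)
  have "x n j + \<alpha> n *\<^sub>R (xinx n j - x n j) \<in> K" if "j < I" for j
  proof -
    have "(1 - \<alpha> n) *\<^sub>R x n j + \<alpha> n *\<^sub>R xinx n j \<in> K"
      using K Suc.IH[OF that] xinx_in[OF that] \<alpha>_nonneg[of n] \<alpha>_range(2)[of n] by (auto simp: convex_alt)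
    then show ?thesis by (simp add: algebra_simps)
  qed
  then show ?case using Suc.prems by (simp add: x_upd mix_in)
qed (rule init_x)

lemma xt_vi:
  assumes "i < I" "v \<in> K"
  shows "0 \<le> (gradft i (xt n i) (x n i) + pr n i) \<bullet> (v - xt n i) + G v - G (xt n i)"
  unfolding pr_def by (rule xt_variational[OF assms(1) x_in[OF assms(1)] assms(2)])

lemma mean_in:
  assumes "\<And>i. i < I \<Longrightarrow> v i \<in> K" shows "mean I v \<in> K"
proof -
  have "(\<Sum>i<I. (1 / of_nat I) *\<^sub>R v i) \<in> K"
    using assms I_pos by (intro convex_sum K) auto
  then show ?thesis by (simp add: mean_def scaleR_sum_right)
qed

lemma xb_in: "xb n \<in> K"
  unfolding xb_def by (rule mean_in) (rule x_in)

lemma norm_x_xb: "i < I \<Longrightarrow> norm (x n i - xb n) \<le> X n"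
  unfolding X_def by (rule norm_le_total_norm)

lemma norm_y_yb: "i < I \<Longrightarrow> norm (y n i - yb n) \<le> Y n"
  unfolding Y_def by (rule norm_le_total_norm)

lemma gradf_diff: "i < I \<Longrightarrow> u \<in> K \<Longrightarrow> v \<in> K \<Longrightarrow> norm (gradf i u - gradf i v) \<le> Lip * norm (u - v)"
  using lipschitz_onD[OF gradf_lip] by (simp add: dist_norm)

lemma gradft_diff: "i < I \<Longrightarrow> r \<in> K \<Longrightarrow> u \<in> K \<Longrightarrow> v \<in> K \<Longrightarrow>
    norm (gradft i r u - gradft i r v) \<le> Lip * norm (u - v)"
  using lipschitz_onD[OF gradft_lip] by (simp add: dist_norm)

text \<open>The tracking invariant: mixing preserves sums, the added gradient differences telescope,
  and the initialization starts with equality.\<close>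

lemma sum_y: "(\<Sum>i<I. y n i) = (\<Sum>i<I. gradf i (x n i))"
proof (induction n)
  case (Suc n)
  have "(\<Sum>i<I. y (Suc n) i) = (\<Sum>i<I. mix n (y n) i + (gradf i (x (Suc n) i) - gradf i (x n i)))"
    by (intro sum.cong) (auto simp: y_upd)
  then show ?case by (simp add: sum.distrib sum_subtractf sum_mix Suc)
qed (simp add: init_y)

lemma yb_tracks: "norm (of_nat I *\<^sub>R yb n - gradF (xb n)) \<le> Lip * X n"
proof -
  have "of_nat I *\<^sub>R yb n - gradF (xb n) = (\<Sum>i<I. gradf i (x n i) - gradf i (xb n))"
    using I_pos by (simp add: yb_def gradF_def sum_eq_scaleR_mean[symmetric] sum_y sum_subtractf)
  also have "norm \<dots> \<le> (\<Sum>i<I. Lip * norm (x n i - xb n))"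
    by (intro sum_norm_le gradf_diff x_in xb_in) auto
  also have "\<dots> = Lip * X n" by (simp add: X_def total_norm_def sum_distrib_left)
  finally show ?thesis .
qed

text \<open>Split into the deviation from the mean, the tracking error of the mean, and
  \<open>gradF (xb n)\<close>, the one part that \<open>LF\<close> controls.\<close>

lemma norm_y_le:
  assumes i: "i < I"
  shows "norm (of_nat I *\<^sub>R y n i) \<le> I * Y n + LF + Lip * X n"
proof -
  let ?a = "of_nat I *\<^sub>R (y n i - yb n)" and ?b = "of_nat I *\<^sub>R yb n - gradF (xb n)"
  have "of_nat I *\<^sub>R y n i = ?a + ?b + gradF (xb n)" by (simp add: algebra_simps)
  then have "norm (of_nat I *\<^sub>R y n i) \<le> norm ?a + norm ?b + norm (gradF (xb n))"
    by (simp only:) (intro order_trans[OF norm_triangle_ineq] add_right_mono norm_triangle_ineq)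
  moreover have "norm ?a \<le> I * Y n" using norm_y_yb[OF i, of n] by (simp add: mult_left_mono)
  moreover have "norm (gradF (xb n)) \<le> LF" unfolding gradF_def by (rule gradF_bdd[OF xb_in])
  ultimately show ?thesis using yb_tracks[of n] by linarith
qed

text \<open>The comparison inequality that replaces the Lipschitz best-response map: only the second
  argument of \<open>gradft\<close> is perturbed, so no regularity in the first argument is needed.\<close>

lemma xt_compare:
  assumes i: "i < I" and v: "v \<in> K"
  shows "\<tau> * (norm (xt n i - v))\<^sup>2 + G (xt n i) - G v \<le> (gradft i v (x n i) + pr n i) \<bullet> (v - xt n i)"
proof -
  have "\<tau> * (norm (xt n i - v))\<^sup>2 \<le> (gradft i (xt n i) (x n i) - gradft i v (x n i)) \<bullet> (xt n i - v)"
    by (intro gradft_mono i v xt_in x_in)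
  then show ?thesis using xt_vi[OF i v, of n]
    by (simp add: inner_diff_left inner_diff_right inner_add_left)
qed

lemma xt_x_le:
  assumes i: "i < I" shows "\<tau> * norm (xt n i - x n i) \<le> I * Y n + Lip * X n + LF + LG"
proof -
  let ?r = "norm (xt n i - x n i)"
  \<comment> \<open>On the diagonal \<open>gradft\<close> equals \<open>gradf\<close>, which cancels
    against \<open>pr\<close> and leaves the multiple of \<open>y n i\<close>.\<close>
  have "\<tau> * ?r\<^sup>2 + G (xt n i) - G (x n i) \<le> (of_nat I *\<^sub>R y n i) \<bullet> (x n i - xt n i)"
    using xt_compare[OF i x_in[OF i], of n n] by (simp add: pr_def gradft_diag i x_in)
  moreover have "(of_nat I *\<^sub>R y n i) \<bullet> (x n i - xt n i) \<le> norm (of_nat I *\<^sub>R y n i) * ?r"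
    using norm_cauchy_schwarz[of "of_nat I *\<^sub>R y n i" "x n i - xt n i"] by (simp add: norm_minus_commute)
  moreover have "G (x n i) - G (xt n i) \<le> LG * ?r"
    using G_lip[OF x_in[OF i] xt_in[OF i]] by (simp add: norm_minus_commute)
  ultimately have "\<tau> * ?r\<^sup>2 \<le> (norm (of_nat I *\<^sub>R y n i) + LG) * ?r" by (simp add: algebra_simps)
  from le_of_square_le[OF this] have "\<tau> * ?r \<le> norm (of_nat I *\<^sub>R y n i) + LG" using LG by simp
  then show ?thesis using norm_y_le[OF i, of n] by simp
qed

lemma D_le: obtains c where "0 \<le> c" "\<And>n. total_norm I (D n) \<le> c * (1 + X n + Y n)"
    "\<And>n i. i < I \<Longrightarrow> norm (xt n i - x n i) \<le> c * (1 + X n + Y n)"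
proof -
  define b where "b = (real I + Lip + \<bar>LF\<bar> + LG) / \<tau>"
  have b: "0 \<le> b" using \<tau> LG Lip_nonneg by (simp add: b_def)
  have xt: "norm (xt n i - x n i) \<le> b * (1 + X n + Y n)" if i: "i < I" for n i
  proof -
    have "\<tau> * norm (xt n i - x n i) \<le> I * Y n + Lip * X n + LF + LG" by (rule xt_x_le[OF i])
    also have "\<dots> \<le> (real I + Lip + \<bar>LF\<bar> + LG) * (1 + X n + Y n)"
    proof -
      have "0 \<le> real I * X n" "0 \<le> Lip * Y n" "0 \<le> \<bar>LF\<bar> * (X n + Y n)" "0 \<le> LG * (X n + Y n)"
        using X_nonneg Y_nonneg Lip_nonneg LG by auto
      then show ?thesis using I_real Lip_nonneg by (simp add: algebra_simps)
    qed
    finally show ?thesis using \<tau> by (simp add: b_def field_simps)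
  qed
  have D: "norm (D n i) \<le> (b + \<epsilon>\<^sub>0) * (1 + X n + Y n)" if i: "i < I" for n i
  proof -
    have "norm (D n i) \<le> norm (xinx n i - xt n i) + norm (xt n i - x n i)"
      unfolding D_def using norm_triangle_ineq[of "xinx n i - xt n i" "xt n i - x n i"] by simp
    also have "\<dots> \<le> \<epsilon>\<^sub>0 + b * (1 + X n + Y n)"
      using xinx_err[OF i, of n] \<epsilon>_le[OF i, of n] xt[OF i, of n] by simp
    also have "\<dots> \<le> (b + \<epsilon>\<^sub>0) * (1 + X n + Y n)"
      using \<epsilon>\<^sub>0_nonneg X_nonneg[of n] Y_nonneg[of n] by (simp add: algebra_simps)
    finally show ?thesis .
  qed
  have "total_norm I (D n) \<le> I * (b + \<epsilon>\<^sub>0) * (1 + X n + Y n)" for n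
    unfolding total_norm_def
    using sum_bounded_above[of "{..<I}" "\<lambda>i. norm (D n i)" "(b + \<epsilon>\<^sub>0) * (1 + X n + Y n)"] D
    by (simp add: mult.assoc)
  moreover have "b * (1 + X n + Y n) \<le> I * (b + \<epsilon>\<^sub>0) * (1 + X n + Y n)" for n
  proof (rule mult_right_mono)
    show "b \<le> I * (b + \<epsilon>\<^sub>0)" using mult_right_mono[OF I_real, of "b + \<epsilon>\<^sub>0"] b \<epsilon>\<^sub>0_nonneg by simp
  qed (use X_nonneg[of n] Y_nonneg[of n] in simp)
  ultimately show thesis using b \<epsilon>\<^sub>0_nonneg order_trans[OF xt]
    by (intro that[of "I * (b + \<epsilon>\<^sub>0)"]) auto
qed

section \<open>Coupled dynamics of the disagreements\<close>

lemma x_step: "i < I \<Longrightarrow> x (Suc n) i = mix n (x n) i + \<alpha> n *\<^sub>R mix n (D n) i"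
  by (simp add: x_upd mix_add mix_scaleR D_def[abs_def])

lemma xb_step: "xb (Suc n) = xb n + \<alpha> n *\<^sub>R mean I (D n)"
proof -
  have "(\<Sum>i<I. x (Suc n) i) = (\<Sum>i<I. mix n (x n) i) + \<alpha> n *\<^sub>R (\<Sum>i<I. mix n (D n) i)"
    by (simp add: x_step sum.distrib scaleR_sum_right)
  then show ?thesis by (simp add: xb_def mean_def sum_mix scaleR_right_distrib)
qed

text \<open>\<open>2 * X n\<close> carries no factor \<open>\<alpha> n\<close>, because mixing alone
  already moves the agents. Through the gradient differences it becomes the feedback into the
  \<open>y\<close> variables.\<close>

lemma x_increment: "total_norm I (\<lambda>i. x (Suc n) i - x n i) \<le> 2 * X n + \<alpha> n * total_norm I (D n)"
proof -
  have "total_norm I (\<lambda>i. x (Suc n) i - x n i)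
      = total_norm I (\<lambda>i. (mix n (x n) i - x n i) + \<alpha> n *\<^sub>R mix n (D n) i)"
    by (rule total_norm_cong) (simp add: x_step)
  also have "\<dots> \<le> total_norm I (\<lambda>i. mix n (x n) i - x n i) + total_norm I (\<lambda>i. \<alpha> n *\<^sub>R mix n (D n) i)"
    by (rule total_norm_triangle)
  also have "\<dots> \<le> 2 * X n + \<alpha> n * total_norm I (D n)"
    using \<alpha>_nonneg[of n] unfolding X_def xb_def total_norm_scaleR
    by (intro add_mono total_norm_mix_diff) (simp add: mult_left_mono total_norm_mix)
  finally show ?thesis .
qed

lemma gradf_increment:
  "total_norm I (\<lambda>i. gradf i (x (Suc n) i) - gradf i (x n i)) \<le> Lip * total_norm I (\<lambda>i. x (Suc n) i - x n i)"
  unfolding total_norm_def sum_distrib_left by (intro sum_mono gradf_diff x_in) auto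

lemma y_increment:
  "total_norm I (\<lambda>i. y (Suc n) i - y n i) \<le> 2 * Y n + Lip * total_norm I (\<lambda>i. x (Suc n) i - x n i)"
proof -
  have "total_norm I (\<lambda>i. y (Suc n) i - y n i)
      = total_norm I (\<lambda>i. (mix n (y n) i - y n i) + (gradf i (x (Suc n) i) - gradf i (x n i)))"
    by (rule total_norm_cong) (simp add: y_upd)
  also have "\<dots> \<le> total_norm I (\<lambda>i. mix n (y n) i - y n i)
      + total_norm I (\<lambda>i. gradf i (x (Suc n) i) - gradf i (x n i))"
    by (rule total_norm_triangle)
  also have "\<dots> \<le> 2 * Y n + Lip * total_norm I (\<lambda>i. x (Suc n) i - x n i)"
    unfolding Y_def yb_def by (intro add_mono total_norm_mix_diff gradf_increment)
  finally show ?thesis .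
qed

text \<open>Small gain: \<open>M\<close> is so large that the feedback of the disagreement in \<open>x\<close> into that in \<open>y\<close>
  is absorbed by the contraction.\<close>

lemma disagreement_feedback:
  obtains p \<mu> c where "\<And>n. X n + Y n \<le> p n" "0 \<le> \<mu>" "\<mu> < 1" "0 \<le> c"
    "\<And>n. p (Suc n) \<le> \<mu> * p n + c * \<alpha> n * (1 + p n)"
proof -
  obtain c where c: "0 \<le> c" "\<And>n. total_norm I (D n) \<le> c * (1 + X n + Y n)" using D_le by metis
  obtain \<rho> C where \<rho>: "0 < \<rho>" "\<rho> < 1" "0 < C"
    and cons: "\<And>v e :: nat \<Rightarrow> nat \<Rightarrow> 'a. (\<And>n i. i < I \<Longrightarrow> v (Suc n) i = mix n (v n) i + e n i) \<Longrightarrow>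
       \<exists>a. (\<forall>n. total_norm I (\<lambda>i. v n i - mean I (v n)) \<le> a n)
         \<and> (\<forall>n. a (Suc n) = \<rho> * a n + C * total_norm I (e n))"
    using perturbed_consensus by metis
  obtain a where a: "\<And>n. X n \<le> a n"
    "\<And>n. a (Suc n) = \<rho> * a n + C * total_norm I (\<lambda>i. \<alpha> n *\<^sub>R mix n (D n) i)"
    using cons[of x "\<lambda>n i. \<alpha> n *\<^sub>R mix n (D n) i"] x_step unfolding X_def xb_def by blast
  obtain b where b: "\<And>n. Y n \<le> b n"
    "\<And>n. b (Suc n) = \<rho> * b n + C * total_norm I (\<lambda>i. gradf i (x (Suc n) i) - gradf i (x n i))"
    using cons[of y "\<lambda>n i. gradf i (x (Suc n) i) - gradf i (x n i)"] y_upd unfolding Y_def yb_def by blast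
  \<comment> \<open>The coefficient of \<open>a n\<close> in
    \<open>M * a (Suc n) + b (Suc n)\<close> is \<open>M * \<rho> + 2 * C * Lip\<close>. With the
    midpoint rate \<open>\<mu>\<close> it is at most \<open>\<mu> * M\<close> once
    \<open>M \<ge> 4 * C * Lip / (1 - \<rho>)\<close>; the extra 1 ensures
    \<open>a n + b n \<le> p n\<close>.\<close>
  define M where "M = 1 + 4 * C * Lip / (1 - \<rho>)"
  define \<mu> where "\<mu> = (1 + \<rho>) / 2"
  have "M * (1 - \<rho>) = 1 - \<rho> + 4 * C * Lip" using \<rho> by (simp add: M_def field_simps)
  then have "M * \<rho> + 2 * C * Lip \<le> \<mu> * M" using \<rho> by (simp add: \<mu>_def field_simps)
  moreover have "1 \<le> M" using \<rho> Lip_nonneg by (simp add: M_def)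
  ultimately have M: "1 \<le> M" "M * \<rho> + 2 * C * Lip \<le> \<mu> * M" by auto
  have ab0: "0 \<le> a n" "0 \<le> b n" for n
    using a(1)[of n] b(1)[of n] X_nonneg[of n] Y_nonneg[of n] by auto
  have \<alpha>D: "\<alpha> n * total_norm I (D n) \<le> \<alpha> n * (c * (1 + a n + b n))" for n
    using c a(1)[of n] b(1)[of n] \<alpha>_nonneg[of n]
    by (intro mult_left_mono order_trans[OF c(2)]) auto
  have a_step: "a (Suc n) \<le> \<rho> * a n + C * (\<alpha> n * (c * (1 + a n + b n)))" for n
    unfolding a(2) total_norm_scaleR using \<rho> \<alpha>_nonneg[of n]
    by (intro add_left_mono mult_left_mono order_trans[OF _ \<alpha>D]) (auto intro!: mult_left_mono total_norm_mix)
  have b_step: "b (Suc n) \<le> \<rho> * b n + C * (Lip * (2 * a n + \<alpha> n * (c * (1 + a n + b n))))" for n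
    unfolding b(2) using \<rho> Lip_nonneg
    by (intro add_left_mono mult_left_mono order_trans[OF gradf_increment] order_trans[OF x_increment]
         add_mono \<alpha>D a(1)) auto
  define p where "p n = M * a n + b n" for n
  have ab: "a n + b n \<le> p n" for n using mult_right_mono[OF M(1) ab0(1)[of n]] by (simp add: p_def)
  have "p (Suc n) \<le> \<mu> * p n + (M * C * c + C * Lip * c) * \<alpha> n * (1 + p n)" for n
  proof -
    have "p (Suc n) \<le> M * (\<rho> * a n + C * (\<alpha> n * (c * (1 + a n + b n))))
        + (\<rho> * b n + C * (Lip * (2 * a n + \<alpha> n * (c * (1 + a n + b n)))))"
      unfolding p_def using M by (intro add_mono mult_left_mono a_step b_step) auto
    also have "\<dots> = (M * \<rho> + 2 * C * Lip) * a n + \<rho> * b n + (M * C * c + C * Lip * c) * \<alpha> n * (1 + (a n + b n))"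
      by (simp add: algebra_simps)
    also have "\<dots> \<le> (\<mu> * M) * a n + \<mu> * b n + (M * C * c + C * Lip * c) * \<alpha> n * (1 + p n)"
      using M \<rho> c(1) Lip_nonneg ab0[of n] \<alpha>_nonneg[of n] ab[of n]
      by (intro add_mono mult_right_mono mult_left_mono add_left_mono) (auto simp: \<mu>_def)
    finally show ?thesis by (simp add: p_def algebra_simps)
  qed
  moreover have "X n + Y n \<le> p n" for n using a(1)[of n] b(1)[of n] ab[of n] by simp
  moreover have "0 \<le> \<mu>" "\<mu> < 1" using \<rho> by (auto simp: \<mu>_def)
  moreover have "0 \<le> M * C * c + C * Lip * c" using M \<rho> c Lip_nonneg by simp
  ultimately show thesis by (intro that[of p \<mu> "M * C * c + C * Lip * c"]) auto
qed


text \<open>A bootstrap: the feedback inequality first bounds \<open>p\<close>, and the bound then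
  turns its multiplicative term into a constant times \<open>\<alpha> n\<close>.\<close>

lemma disagreement:
  obtains p \<mu> c P where "\<And>n. 0 \<le> p n" "\<And>n. X n + Y n \<le> p n" "0 \<le> \<mu>" "\<mu> < 1" "0 \<le> c"
    "\<And>n. p (Suc n) \<le> \<mu> * p n + c * \<alpha> n" "\<And>n. p n \<le> P"
proof -
  obtain p \<mu> c where p: "\<And>n. X n + Y n \<le> p n" "0 \<le> \<mu>" "\<mu> < 1" "0 \<le> c"
    "\<And>n. p (Suc n) \<le> \<mu> * p n + c * \<alpha> n * (1 + p n)"
    using disagreement_feedback by metis
  have p0: "0 \<le> p n" for n using p(1)[of n] X_nonneg[of n] Y_nonneg[of n] by simp
  obtain P where P: "0 \<le> P" "\<And>n. p n \<le> P"
    using bounded_of_contracting_recursion[OF p0 p(2-4) \<alpha>_nonneg \<alpha>_tendsto p(5)] by auto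
  have "p (Suc n) \<le> \<mu> * p n + c * (1 + P) * \<alpha> n" for n
  proof -
    have "c * \<alpha> n * (1 + p n) \<le> c * \<alpha> n * (1 + P)"
      using P(2) p(4) \<alpha>_nonneg by (intro mult_left_mono) auto
    then show ?thesis using p(5)[of n] by (simp add: mult_ac)
  qed
  then show thesis using p P p0 by (intro that[of p \<mu> "c * (1 + P)" P]) auto
qed

lemma directions_bounded:
  obtains R where "0 \<le> R" "\<And>n. total_norm I (D n) \<le> R"
    "\<And>n i. i < I \<Longrightarrow> norm (d n i) \<le> R" "\<And>n i. i < I \<Longrightarrow> norm (xinx n i - xb n) \<le> R"
proof -
  obtain c where c: "0 \<le> c" "\<And>n. total_norm I (D n) \<le> c * (1 + X n + Y n)"
    "\<And>n i. i < I \<Longrightarrow> norm (xt n i - x n i) \<le> c * (1 + X n + Y n)" using D_le by metis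
  obtain p P where p: "\<And>n. X n + Y n \<le> p n" "\<And>n. p n \<le> P" using disagreement by metis
  define R where "R = c * (1 + P) + P + \<epsilon>\<^sub>0"
  have XY: "X n + Y n \<le> P" for n using p[of n] by (rule order_trans)
  then have P0: "0 \<le> P" using X_nonneg[of 0] Y_nonneg[of 0] add_nonneg_nonneg order_trans by blast
  have cP: "c * (1 + X n + Y n) \<le> c * (1 + P)" for n using c(1) XY[of n] by (intro mult_left_mono) auto
  have d: "norm (d n i) \<le> c * (1 + P) + P" if i: "i < I" for n i
  proof -
    have "norm (d n i) \<le> norm (xt n i - x n i) + norm (x n i - xb n)"
      unfolding d_def using norm_triangle_ineq[of "xt n i - x n i" "x n i - xb n"] by simp
    then show ?thesis using c(3)[OF i, of n] cP[of n] norm_x_xb[OF i, of n] XY[of n] Y_nonneg[of n] by simp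
  qed
  have "norm (xinx n i - xb n) \<le> R" if i: "i < I" for n i
  proof -
    have "norm (xinx n i - xb n) \<le> norm (xinx n i - xt n i) + norm (d n i)"
      unfolding d_def using norm_triangle_ineq[of "xinx n i - xt n i" "xt n i - xb n"] by simp
    then show ?thesis using xinx_err[OF i, of n] \<epsilon>_le[OF i, of n] d[OF i, of n] by (simp add: R_def)
  qed
  moreover have "norm (d n i) \<le> R" if "i < I" for n i
    using d[OF that, of n] \<epsilon>\<^sub>0_nonneg by (simp add: R_def)
  moreover have "total_norm I (D n) \<le> R" for n
    using c(2)[of n] cP[of n] P0 \<epsilon>\<^sub>0_nonneg by (simp add: R_def)
  moreover have "0 \<le> R" using c P0 \<epsilon>\<^sub>0_nonneg by (simp add: R_def)
  ultimately show thesis by (intro that[of R]) auto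
qed

text \<open>At the average, surrogate gradient plus \<open>pr\<close> reproduces the full gradient
  exactly when nobody disagrees. Three Lipschitz comparisons and the deviation of \<open>y\<close>
  give \<open>3 * Lip\<close> and \<open>I\<close>.\<close>

lemma gradient_error:
  assumes i: "i < I"
  shows "norm (gradft i (xb n) (x n i) + pr n i - gradF (xb n)) \<le> (3 * Lip + I) * (X n + Y n)"
proof -
  let ?a = "gradft i (xb n) (x n i) - gradft i (xb n) (xb n)"
    and ?b = "gradf i (xb n) - gradf i (x n i)"
    and ?c = "of_nat I *\<^sub>R (y n i - yb n)"
    and ?e = "of_nat I *\<^sub>R yb n - gradF (xb n)"
  have "gradft i (xb n) (x n i) + pr n i - gradF (xb n) = ?a + ?b + ?c + ?e"
    by (simp add: pr_def gradft_diag[OF i xb_in] algebra_simps)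
  then have "norm (gradft i (xb n) (x n i) + pr n i - gradF (xb n)) \<le> norm ?a + norm ?b + norm ?c + norm ?e"
    by (simp only:) (intro order_trans[OF norm_triangle_ineq] add_right_mono norm_triangle_ineq)
  moreover have "Lip * norm (x n i - xb n) \<le> Lip * X n" by (intro mult_left_mono norm_x_xb i Lip_nonneg)
  then have "norm ?a \<le> Lip * X n" "norm ?b \<le> Lip * X n"
    using gradft_diff[OF i xb_in x_in[OF i] xb_in, of n n n] gradf_diff[OF i x_in[OF i] xb_in, of n n]
    by (simp_all add: norm_minus_commute)
  moreover have "norm ?c \<le> I * Y n"
    using norm_y_yb[OF i, of n] by (simp add: mult_left_mono)
  moreover have "Lip * X n + Lip * X n + I * Y n + Lip * X n \<le> (3 * Lip + I) * (X n + Y n)"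
    using Lip_nonneg X_nonneg[of n] Y_nonneg[of n] by (simp add: algebra_simps)
  ultimately show ?thesis using yb_tracks[of n] by linarith
qed

section \<open>Descent of the objective along the average\<close>

definition U :: "'a \<Rightarrow> real" where "U u = (\<Sum>i<I. f i u) + G u"

lemma F_deriv: "u \<in> K \<Longrightarrow> ((\<lambda>u. \<Sum>i<I. f i u) has_derivative (\<lambda>h. gradF u \<bullet> h)) (at u)"
  unfolding gradF_def inner_sum_left by (intro has_derivative_sum f_deriv) auto

lemma gradF_lip: "(I * Lip)-lipschitz_on K gradF"
proof (rule lipschitz_onI)
  fix u v assume uv: "u \<in> K" "v \<in> K"
  have "norm (gradF u - gradF v) \<le> (\<Sum>i<I. Lip * norm (u - v))"
    unfolding gradF_def sum_subtractf[symmetric] using uv by (intro sum_norm_le gradf_diff) auto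
  then show "dist (gradF u) (gradF v) \<le> I * Lip * dist u v" by (simp add: dist_norm)
qed (use Lip_nonneg in simp)

lemma G_continuous: "continuous_on UNIV G"
  by (rule convex_on_continuous[OF open_UNIV G_convex])

lemma U_continuous: "continuous_on K U"
proof -
  have "continuous_on K (\<lambda>u. \<Sum>i<I. f i u)"
    by (intro continuous_at_imp_continuous_on ballI has_derivative_continuous[OF F_deriv])
  then show ?thesis unfolding U_def
    by (intro continuous_on_add continuous_on_subset[OF G_continuous]) auto
qed

text \<open>Subtracting \<open>x n i\<close> or \<open>xb n\<close> from \<open>xinx n i\<close>
  leaves the same mean, so all agents can share the base point \<open>xb n\<close>.\<close>

lemma xb_step': "xb (Suc n) - xb n = mean I (\<lambda>i. \<alpha> n *\<^sub>R (xinx n i - xb n))"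
proof -
  have "mean I (\<lambda>i. xinx n i - xb n) = mean I (D n)"
    using I_pos by (simp add: mean_def D_def sum_subtractf xb_def sum_constant_scaleR)
  moreover have "mean I (\<lambda>i. \<alpha> n *\<^sub>R (xinx n i - xb n)) = \<alpha> n *\<^sub>R mean I (\<lambda>i. xinx n i - xb n)"
    by (simp add: mean_def scaleR_sum_right[symmetric])
  ultimately show ?thesis by (simp add: xb_step)
qed

text \<open>The new average is a mean of points on the segments from \<open>xb n\<close> to
  \<open>xinx n i\<close>; Jensen across agents and convexity along each segment suffice.\<close>

lemma G_step: "G (xb (Suc n)) - G (xb n) \<le> \<alpha> n / I * (\<Sum>i<I. G (xinx n i) - G (xb n))"
proof -
  have eq: "xb (Suc n) = (\<Sum>i<I. (1 / I) *\<^sub>R ((1 - \<alpha> n) *\<^sub>R xb n + \<alpha> n *\<^sub>R xinx n i))"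
  proof -
    have "xb (Suc n) = xb n + mean I (\<lambda>i. \<alpha> n *\<^sub>R (xinx n i - xb n))"
      using xb_step'[of n] by (simp add: algebra_simps)
    also have "\<dots> = mean I (\<lambda>i. xb n + \<alpha> n *\<^sub>R (xinx n i - xb n))"
      using I_pos unfolding mean_def sum.distrib scaleR_right_distrib by (simp add: sum_constant_scaleR)
    also have "(\<lambda>i. xb n + \<alpha> n *\<^sub>R (xinx n i - xb n)) = (\<lambda>i. (1 - \<alpha> n) *\<^sub>R xb n + \<alpha> n *\<^sub>R xinx n i)"
      by (simp add: algebra_simps fun_eq_iff)
    finally show ?thesis by (simp add: mean_def scaleR_sum_right)
  qed
  have "G (xb (Suc n)) \<le> (\<Sum>i<I. 1 / I * G ((1 - \<alpha> n) *\<^sub>R xb n + \<alpha> n *\<^sub>R xinx n i))"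
    unfolding eq using I_pos by (intro convex_on_sum[OF _ _ G_convex]) (auto simp: lessThan_empty_iff)
  also have "\<dots> \<le> (\<Sum>i<I. 1 / I * ((1 - \<alpha> n) * G (xb n) + \<alpha> n * G (xinx n i)))"
    using \<alpha>_range(2)[of n] \<alpha>_nonneg[of n]
    by (intro sum_mono mult_left_mono convex_onD[OF G_convex]) auto
  also have "\<dots> = (\<Sum>i<I. 1 / I * G (xb n) + \<alpha> n / I * (G (xinx n i) - G (xb n)))"
    by (intro sum.cong) (simp_all add: field_simps)
  also have "\<dots> = G (xb n) + \<alpha> n / I * (\<Sum>i<I. G (xinx n i) - G (xb n))"
    using I_pos by (simp add: sum.distrib sum_distrib_left)
  finally show ?thesis by simp
qed

text \<open>Strong monotonicity supplies the quadratic gain, the gradient error the linear term, and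
  replacing \<open>xt n i\<close> by \<open>xinx n i\<close> costs \<open>LF + LG\<close> times the
  tolerance.\<close>

lemma agent_descent:
  assumes i: "i < I"
  shows "G (xinx n i) - G (xb n) + gradF (xb n) \<bullet> (xinx n i - xb n)
    \<le> - \<tau> * (norm (d n i))\<^sup>2 + (3 * Lip + I) * (X n + Y n) * norm (d n i) + (LF + LG) * \<epsilon> n i"
proof -
  define e where "e = gradft i (xb n) (x n i) + pr n i - gradF (xb n)"
  have "G (xt n i) - G (xb n) + gradF (xb n) \<bullet> d n i \<le> - \<tau> * (norm (d n i))\<^sup>2 - e \<bullet> d n i"
    using xt_compare[OF i xb_in, of n n] by (simp add: d_def e_def inner_simps)
  moreover have "- (e \<bullet> d n i) \<le> (3 * Lip + I) * (X n + Y n) * norm (d n i)"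
    using norm_cauchy_schwarz[of "- e" "d n i"]
      mult_right_mono[OF gradient_error[OF i, of n], of "norm (d n i)"]
    by (simp add: e_def[symmetric])
  moreover have "G (xinx n i) - G (xt n i) \<le> LG * \<epsilon> n i"
    using G_lip[OF xinx_in[OF i] xt_in[OF i], of n n] mult_left_mono[OF xinx_err[OF i, of n] LG] by linarith
  moreover have "gradF (xb n) \<bullet> (xinx n i - xt n i) \<le> LF * \<epsilon> n i"
    using gradF_bdd[OF xb_in, of n] xinx_err[OF i, of n]
    by (intro order_trans[OF norm_cauchy_schwarz] mult_mono) (auto simp: gradF_def intro: order_trans[OF norm_ge_zero])
  moreover have "gradF (xb n) \<bullet> (xinx n i - xb n)
      = gradF (xb n) \<bullet> (xinx n i - xt n i) + gradF (xb n) \<bullet> d n i"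
    by (simp add: d_def inner_simps)
  ultimately show ?thesis unfolding distrib_right[of LF] by linarith
qed

lemma descent:
  obtains s where "\<And>n. 0 \<le> s n" "summable s"
    "\<And>n. U (xb (Suc n)) \<le> U (xb n) - \<tau> / I * (\<alpha> n * (\<Sum>i<I. (norm (d n i))\<^sup>2)) + s n"
proof -
  obtain R where R: "0 \<le> R" "\<And>n i. i < I \<Longrightarrow> norm (d n i) \<le> R"
    "\<And>n i. i < I \<Longrightarrow> norm (xinx n i - xb n) \<le> R" using directions_bounded by metis
  obtain p \<mu> c where p: "\<And>n. 0 \<le> p n" "\<And>n. X n + Y n \<le> p n" "0 \<le> \<mu>" "\<mu> < 1" "0 \<le> c"
    "\<And>n. p (Suc n) \<le> \<mu> * p n + c * \<alpha> n" using disagreement by metis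
  have p2: "summable (\<lambda>n. (p n)\<^sup>2)"
    by (rule square_summable_of_contracting_recursion[OF p(1) p(3,4) p(6) \<alpha>_sq])
  have LF: "0 \<le> LF" using gradF_bdd[OF xb_in] norm_ge_zero order_trans by blast
  define b where "b = (3 * Lip + I) * R"
  have b: "0 \<le> b" using R Lip_nonneg by (simp add: b_def)
  \<comment> \<open>Disagreement weighted by the step size, inexactness, and the quadratic remainder
    of the descent lemma.\<close>
  define s where "s n = b * (\<alpha> n * p n) + (LF + LG) / I * (\<Sum>i<I. \<alpha> n * \<epsilon> n i) + I * Lip * R\<^sup>2 * (\<alpha> n)\<^sup>2" for n
  have s0: "0 \<le> s n" for n
    unfolding s_def using b p(1) LF LG Lip_nonneg \<alpha>_nonneg \<epsilon>_nonneg
    by (intro add_nonneg_nonneg mult_nonneg_nonneg sum_nonneg divide_nonneg_nonneg) auto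
  have "summable (\<lambda>n. \<alpha> n * p n)"
  proof (rule summable_comparison_test'[of "\<lambda>n. (\<alpha> n)\<^sup>2 + (p n)\<^sup>2"])
    fix n
    have "\<alpha> n * p n \<le> (\<alpha> n)\<^sup>2 + (p n)\<^sup>2"
      using sum_squares_bound[of "\<alpha> n" "p n"] \<alpha>_nonneg[of n] p(1)[of n] mult_nonneg_nonneg[of "\<alpha> n" "p n"]
      by linarith
    then show "norm (\<alpha> n * p n) \<le> (\<alpha> n)\<^sup>2 + (p n)\<^sup>2" using \<alpha>_nonneg[of n] p(1)[of n] by simp
  qed (intro summable_add \<alpha>_sq p2)
  then have "summable s"
    unfolding s_def using \<alpha>_\<epsilon> by (intro summable_add summable_mult summable_sum \<alpha>_sq) auto
  moreover have "U (xb (Suc n)) \<le> U (xb n) - \<tau> / I * (\<alpha> n * (\<Sum>i<I. (norm (d n i))\<^sup>2)) + s n" for n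
  proof -
    have inc: "norm (xb (Suc n) - xb n) \<le> \<alpha> n * R"
    proof -
      have "total_norm I (\<lambda>i. \<alpha> n *\<^sub>R (xinx n i - xb n)) \<le> \<alpha> n * (I * R)"
        using sum_bounded_above[of "{..<I}" "\<lambda>i. norm (xinx n i - xb n)" R] R(3) \<alpha>_nonneg[of n]
        unfolding total_norm_scaleR by (simp add: total_norm_def mult_left_mono)
      then show ?thesis unfolding xb_step' using I_pos
        by (intro order_trans[OF norm_mean_le]) (simp add: field_simps)
    qed
    have "(\<Sum>i<I. f i (xb (Suc n))) \<le> (\<Sum>i<I. f i (xb n)) + gradF (xb n) \<bullet> (xb (Suc n) - xb n)
        + I * Lip * (norm (xb (Suc n) - xb n))\<^sup>2"
      by (rule descent_lemma[OF K(2) xb_in xb_in F_deriv gradF_lip])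
    also have "\<dots> \<le> (\<Sum>i<I. f i (xb n)) + \<alpha> n / I * (\<Sum>i<I. gradF (xb n) \<bullet> (xinx n i - xb n))
        + I * Lip * (\<alpha> n * R)\<^sup>2"
    proof (intro add_mono order_refl mult_left_mono power_mono inc)
      show "gradF (xb n) \<bullet> (xb (Suc n) - xb n) \<le> \<alpha> n / I * (\<Sum>i<I. gradF (xb n) \<bullet> (xinx n i - xb n))"
        by (simp add: xb_step' mean_def scaleR_sum_right[symmetric] inner_sum_right)
    qed (use Lip_nonneg in auto)
    finally have "U (xb (Suc n)) \<le> U (xb n) + \<alpha> n / I * (\<Sum>i<I. G (xinx n i) - G (xb n)
        + gradF (xb n) \<bullet> (xinx n i - xb n)) + I * Lip * (\<alpha> n * R)\<^sup>2"
      using G_step[of n] by (simp add: U_def sum.distrib distrib_left)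
    also have "\<dots> \<le> U (xb n) + \<alpha> n / I * (\<Sum>i<I. - \<tau> * (norm (d n i))\<^sup>2 + b * p n + (LF + LG) * \<epsilon> n i)
        + I * Lip * (\<alpha> n * R)\<^sup>2"
    proof (rule add_right_mono, rule add_left_mono, rule mult_left_mono, rule sum_mono)
      fix i assume "i \<in> {..<I}"
      then have i: "i < I" by simp
      have "(3 * Lip + I) * (X n + Y n) * norm (d n i) \<le> (3 * Lip + I) * p n * R"
        using p(1,2)[of n] Lip_nonneg R(2)[OF i] X_nonneg[of n] Y_nonneg[of n]
        by (intro mult_mono mult_nonneg_nonneg) auto
      then show "G (xinx n i) - G (xb n) + gradF (xb n) \<bullet> (xinx n i - xb n)
          \<le> - \<tau> * (norm (d n i))\<^sup>2 + b * p n + (LF + LG) * \<epsilon> n i"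
        using agent_descent[OF i, of n] by (simp add: b_def mult_ac)
    qed (use \<alpha>_nonneg in auto)
    also have "(\<Sum>i<I. - \<tau> * (norm (d n i))\<^sup>2 + b * p n + (LF + LG) * \<epsilon> n i)
        = - \<tau> * (\<Sum>i<I. (norm (d n i))\<^sup>2) + I * (b * p n) + (LF + LG) * (\<Sum>i<I. \<epsilon> n i)"
      by (simp only: sum.distrib sum_distrib_left[symmetric]) simp
    also have "U (xb n) + \<alpha> n / I * \<dots> + I * Lip * (\<alpha> n * R)\<^sup>2
        = U (xb n) - \<tau> / I * (\<alpha> n * (\<Sum>i<I. (norm (d n i))\<^sup>2)) + s n"
      using I_pos by (simp add: s_def sum_distrib_left[symmetric] power_mult_distrib field_simps)
    finally show ?thesis .
  qed
  ultimately show thesis using s0 by (intro that[of s]) auto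
qed

lemma energy_summable: "summable (\<lambda>n. \<alpha> n * (\<Sum>i<I. (norm (d n i))\<^sup>2))"
  and U_bounded: "\<exists>C. \<forall>n. U (xb n) \<le> C"
proof -
  obtain s where s: "\<And>n. 0 \<le> s n" "summable s"
    "\<And>n. U (xb (Suc n)) \<le> U (xb n) - \<tau> / I * (\<alpha> n * (\<Sum>i<I. (norm (d n i))\<^sup>2)) + s n"
    using descent by metis
  obtain m where m: "\<And>u. u \<in> K \<Longrightarrow> m \<le> U u"
    using coercive_on_bounded_below[OF K(1) U_continuous] coercive unfolding U_def by blast
  have h0: "0 \<le> \<tau> / I * (\<alpha> n * (\<Sum>i<I. (norm (d n i))\<^sup>2))" for n
    using \<tau> \<alpha>_nonneg by (intro mult_nonneg_nonneg sum_nonneg) auto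
  note sd = summable_of_descent[of "\<lambda>n. \<tau> / I * (\<alpha> n * (\<Sum>i<I. (norm (d n i))\<^sup>2))" s m "\<lambda>n. U (xb n)",
      OF h0 s(1,2) m[OF xb_in] s(3)]
  show "\<exists>C. \<forall>n. U (xb n) \<le> C" using sd(2) by blast
  show "summable (\<lambda>n. \<alpha> n * (\<Sum>i<I. (norm (d n i))\<^sup>2))"
    using sd(1) \<tau> I_pos by (subst (asm) summable_cmult_iff) auto
qed

lemma xb_bounded: "bounded (range xb)"
proof -
  obtain C where C: "\<And>n. U (xb n) \<le> C" using U_bounded by blast
  obtain R where R: "\<And>u. u \<in> K \<Longrightarrow> R \<le> norm u \<Longrightarrow> C + 1 \<le> U u"
    using coercive unfolding coercive_on_def U_def by meson
  have "norm (xb n) \<le> R" for n using R[OF xb_in, of n] C[of n] by force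
  then show ?thesis by (auto simp: bounded_iff)
qed

section \<open>Vanishing of the optimality gap and passage to the limit\<close>

lemma xt_increment:
  assumes i: "i < I"
  shows "\<tau> * norm (xt (Suc n) i - xt n i)
    \<le> Lip * norm (x (Suc n) i - x n i) + norm (pr (Suc n) i - pr n i)"
proof (rule le_of_square_le)
  let ?v = "xt (Suc n) i" and ?u = "xt n i"
  \<comment> \<open>Both inequalities below evaluate the surrogate gradient at the same first
    argument \<open>?v\<close>, so \<open>?g\<close> contains only a change of the second argument
    and of \<open>pr\<close>; the values of \<open>G\<close> cancel.\<close>
  let ?g = "(gradft i ?v (x n i) - gradft i ?v (x (Suc n) i)) - (pr (Suc n) i - pr n i)"
  have "\<tau> * (norm (?u - ?v))\<^sup>2 + G ?u - G ?v \<le> (gradft i ?v (x n i) + pr n i) \<bullet> (?v - ?u)"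
    by (rule xt_compare[OF i xt_in[OF i]])
  moreover have "0 \<le> (gradft i ?v (x (Suc n) i) + pr (Suc n) i) \<bullet> (?u - ?v) + G ?u - G ?v"
    by (rule xt_vi[OF i xt_in[OF i]])
  ultimately have "\<tau> * (norm (?v - ?u))\<^sup>2 \<le> ?g \<bullet> (?v - ?u)"
    by (simp add: inner_simps norm_minus_commute)
  also have "\<dots> \<le> norm ?g * norm (?v - ?u)" by (rule norm_cauchy_schwarz)
  also have "\<dots> \<le> (Lip * norm (x (Suc n) i - x n i) + norm (pr (Suc n) i - pr n i)) * norm (?v - ?u)"
    using gradft_diff[OF i xt_in[OF i] x_in[OF i] x_in[OF i], of "Suc n" n "Suc n"]
    by (intro mult_right_mono order_trans[OF norm_triangle_ineq4]) (auto simp: norm_minus_commute)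
  finally show "\<tau> * (norm (?v - ?u))\<^sup>2
    \<le> (Lip * norm (x (Suc n) i - x n i) + norm (pr (Suc n) i - pr n i)) * norm (?v - ?u)" .
qed (use Lip_nonneg in auto)

text \<open>The mixing parts of the increments are of order \<open>X n\<close> and
  \<open>Y n\<close> without a factor \<open>\<alpha> n\<close>, hence the separate middle
  term.\<close>

lemma d_increment:
  obtains c where "0 \<le> c" "\<And>n. total_norm I (d (Suc n)) \<le> total_norm I (d n) + c * (X n + Y n) + c * \<alpha> n"
proof -
  obtain R where R: "0 \<le> R" "\<And>n. total_norm I (D n) \<le> R" using directions_bounded by metis
  define a where "a = (Lip + real I * Lip + Lip) / \<tau>"
  define e where "e = real I * 2 / \<tau>"
  have ae: "0 \<le> a" "0 \<le> e" using Lip_nonneg \<tau> by (auto simp: a_def e_def)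
  define c where "c = 2 * I * a + I * e + I * a * R + R"
  have step: "total_norm I (d (Suc n)) \<le> total_norm I (d n) + c * (X n + Y n) + c * \<alpha> n" for n
  proof -
    let ?x = "total_norm I (\<lambda>i. x (Suc n) i - x n i)"
    have x0: "0 \<le> ?x" by (rule total_norm_nonneg)
    have x: "?x \<le> 2 * X n + \<alpha> n * R"
      using x_increment[of n] mult_left_mono[OF R(2)[of n] \<alpha>_nonneg[of n]] by linarith
    have xt: "norm (xt (Suc n) i - xt n i) \<le> a * ?x + e * Y n" if i: "i < I" for i
    proof -
      have xi: "norm (x (Suc n) i - x n i) \<le> ?x"
        using norm_le_total_norm[OF i, of "\<lambda>i. x (Suc n) i - x n i"] .
      have yi: "norm (y (Suc n) i - y n i) \<le> 2 * Y n + Lip * ?x"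
        using norm_le_total_norm[OF i, of "\<lambda>i. y (Suc n) i - y n i"] y_increment[of n] by simp
      have "norm (pr (Suc n) i - pr n i)
          = norm (of_nat I *\<^sub>R (y (Suc n) i - y n i) - (gradf i (x (Suc n) i) - gradf i (x n i)))"
        by (simp add: pr_def algebra_simps)
      also have "\<dots> \<le> real I * (2 * Y n + Lip * ?x) + Lip * ?x"
        using yi gradf_diff[OF i x_in[OF i] x_in[OF i], of "Suc n" n] mult_left_mono[OF xi Lip_nonneg]
        by (intro order_trans[OF norm_triangle_ineq4[of "of_nat I *\<^sub>R (y (Suc n) i - y n i)"]] add_mono)
          (auto simp: mult_left_mono)
      finally have "\<tau> * norm (xt (Suc n) i - xt n i) \<le> Lip * ?x + (real I * (2 * Y n + Lip * ?x) + Lip * ?x)"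
        using xt_increment[OF i, of n] mult_left_mono[OF xi Lip_nonneg] by linarith
      also have "\<dots> = \<tau> * (a * ?x + e * Y n)"
        using \<tau> by (simp add: a_def e_def field_simps)
      finally show ?thesis using \<tau> by simp
    qed
    have mean: "norm (xb (Suc n) - xb n) \<le> \<alpha> n * (R / I)"
    proof -
      have "norm (mean I (D n)) \<le> R / I"
        by (rule order_trans[OF norm_mean_le]) (simp add: divide_right_mono R(2))
      then have "\<alpha> n * norm (mean I (D n)) \<le> \<alpha> n * (R / I)" by (intro mult_left_mono \<alpha>_nonneg)
      then show ?thesis using \<alpha>_nonneg[of n] by (simp add: xb_step)
    qed
    have "norm (d (Suc n) i) \<le> norm (d n i) + (a * ?x + e * Y n + \<alpha> n * (R / I))" if i: "i < I" for i
    proof -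
      have "d (Suc n) i = d n i + (xt (Suc n) i - xt n i) - (xb (Suc n) - xb n)" by (simp add: d_def)
      also have "norm \<dots> \<le> norm (d n i) + norm (xt (Suc n) i - xt n i) + norm (xb (Suc n) - xb n)"
        by (intro order_trans[OF norm_triangle_ineq4] add_right_mono norm_triangle_ineq)
      finally show ?thesis using xt[OF i] mean by linarith
    qed
    then have "total_norm I (d (Suc n)) \<le> (\<Sum>i<I. norm (d n i) + (a * ?x + e * Y n + \<alpha> n * (R / I)))"
      unfolding total_norm_def[of _ "d (Suc n)"] by (intro sum_mono) auto
    also have "\<dots> = total_norm I (d n) + I * (a * ?x + e * Y n + \<alpha> n * (R / I))"
      unfolding sum.distrib[of "\<lambda>i. norm (d n i)"] by (simp add: total_norm_def)
    also have "\<dots> = total_norm I (d n) + I * a * ?x + I * e * Y n + \<alpha> n * R"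
      using I_pos by (simp add: distrib_left)
    also have "\<dots> \<le> total_norm I (d n) + I * a * (2 * X n + \<alpha> n * R) + I * e * Y n + \<alpha> n * R"
      using x ae by (intro add_mono mult_left_mono order_refl) auto
    also have "\<dots> \<le> total_norm I (d n) + c * (X n + Y n) + c * \<alpha> n"
    proof -
      have "0 \<le> (I * e + I * a * R + R) * X n + (2 * I * a + I * a * R + R) * Y n + (2 * I * a + I * e) * \<alpha> n"
        using ae R(1) X_nonneg[of n] Y_nonneg[of n] \<alpha>_nonneg[of n] by simp
      then show ?thesis by (simp add: c_def algebra_simps)
    qed
    finally show ?thesis .
  qed
  have "0 \<le> c" using ae R(1) by (simp add: c_def)
  with step show thesis by (rule that[rotated])
qed

lemma limits: "X \<longlonglongrightarrow> 0" "Y \<longlonglongrightarrow> 0" "(\<lambda>n. total_norm I (d n)) \<longlonglongrightarrow> 0"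
proof -
  obtain p \<mu> c where p: "\<And>n. 0 \<le> p n" "\<And>n. X n + Y n \<le> p n" "0 \<le> \<mu>" "\<mu> < 1" "0 \<le> c"
    "\<And>n. p (Suc n) \<le> \<mu> * p n + c * \<alpha> n" using disagreement by metis
  have p2: "summable (\<lambda>n. (p n)\<^sup>2)"
    by (rule square_summable_of_contracting_recursion[OF p(1) p(3,4) p(6) \<alpha>_sq])
  have "(\<lambda>n. sqrt ((p n)\<^sup>2)) \<longlonglongrightarrow> sqrt 0"
    by (intro tendsto_real_sqrt summable_LIMSEQ_zero p2)
  then have plim: "p \<longlonglongrightarrow> 0" by (simp add: p(1))
  have "X n \<le> p n" "Y n \<le> p n" for n using p(2)[of n] X_nonneg[of n] Y_nonneg[of n] by auto
  then show "X \<longlonglongrightarrow> 0" "Y \<longlonglongrightarrow> 0"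
    by (auto intro!: Lim_null_comparison[OF _ plim] simp: X_nonneg Y_nonneg)
  obtain r where r: "0 \<le> r"
    "\<And>n. total_norm I (d (Suc n)) \<le> total_norm I (d n) + r * (X n + Y n) + r * \<alpha> n"
    using d_increment by metis
  \<comment> \<open>Chosen so that \<open>M * \<mu> + r = M\<close>: in \<open>b\<close> the
    contraction of \<open>M * p n\<close> absorbs the growth \<open>r * p n\<close> of the gap,
    leaving increments of order \<open>\<alpha> n\<close>.\<close>
  define M where "M = r / (1 - \<mu>)"
  have M: "0 \<le> M" "M * \<mu> + r = M" using r p by (auto simp: M_def field_simps)
  define b where "b n = total_norm I (d n) + M * p n" for n
  have b0: "0 \<le> b n" for n using M p(1) total_norm_nonneg[of I "d n"] by (simp add: b_def)
  have b_step: "b (Suc n) \<le> b n + (r + M * c) * \<alpha> n" for n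
  proof -
    have "b (Suc n) \<le> (total_norm I (d n) + r * p n + r * \<alpha> n) + M * (\<mu> * p n + c * \<alpha> n)"
      unfolding b_def using M p(6)[of n] r(2)[of n] mult_left_mono[OF p(2)[of n] r(1)]
      by (intro add_mono mult_left_mono) auto
    also have "\<dots> = total_norm I (d n) + (M * \<mu> + r) * p n + (r + M * c) * \<alpha> n"
      by (simp add: algebra_simps)
    finally show ?thesis by (simp add: M b_def)
  qed
  have "summable (\<lambda>n. \<alpha> n * (b n)\<^sup>2)"
  proof (rule summable_comparison_test')
    show "summable (\<lambda>n. 2 * I * (\<alpha> n * (\<Sum>i<I. (norm (d n i))\<^sup>2)) + 2 * M\<^sup>2 * (p n)\<^sup>2)"
      by (intro summable_add summable_mult energy_summable p2)
    fix n
    have "(b n)\<^sup>2 \<le> 2 * (total_norm I (d n))\<^sup>2 + 2 * (M * p n)\<^sup>2"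
      using sum_squares_bound[of "total_norm I (d n)" "M * p n"] by (simp add: b_def power2_sum)
    also have "(total_norm I (d n))\<^sup>2 \<le> I * (\<Sum>i<I. (norm (d n i))\<^sup>2)"
      unfolding total_norm_def using sum_squared_le_sum_of_squares[of "\<lambda>i. norm (d n i)" "{..<I}"] by (simp add: mult.commute)
    finally have "\<alpha> n * (b n)\<^sup>2 \<le> \<alpha> n * (2 * (I * (\<Sum>i<I. (norm (d n i))\<^sup>2)) + 2 * (M * p n)\<^sup>2)"
      using \<alpha>_nonneg[of n] by (intro mult_left_mono) auto
    \<comment> \<open>\<open>\<alpha> n \<le> 1\<close> drops the step size in front of the square
      summable part.\<close>
    also have "\<dots> \<le> 2 * I * (\<alpha> n * (\<Sum>i<I. (norm (d n i))\<^sup>2)) + 2 * M\<^sup>2 * (p n)\<^sup>2"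
      using mult_right_mono[OF \<alpha>_range(2)[of n], of "2 * (M * p n)\<^sup>2"]
      by (simp add: algebra_simps power_mult_distrib)
    finally show "norm (\<alpha> n * (b n)\<^sup>2) \<le> 2 * I * (\<alpha> n * (\<Sum>i<I. (norm (d n i))\<^sup>2)) + 2 * M\<^sup>2 * (p n)\<^sup>2"
      using \<alpha>_nonneg[of n] by simp
  qed
  then have b_lim: "b \<longlonglongrightarrow> 0"
    using r M p(5) by (intro tendsto_zero_of_slow_increase[OF b0 \<alpha>_nonneg \<alpha>_tendsto \<alpha>_div _ b_step]) auto
  show "(\<lambda>n. total_norm I (d n)) \<longlonglongrightarrow> 0"
    by (rule Lim_null_comparison[OF _ b_lim]) (use M p(1) in \<open>simp add: b_def total_norm_nonneg\<close>)
qed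

lemma consensus: "i < I \<Longrightarrow> (\<lambda>n. norm (x n i - xb n)) \<longlonglongrightarrow> 0"
  by (rule Lim_null_comparison[OF _ limits(1)]) (simp add: norm_x_xb)

text \<open>Since \<open>gradft\<close> need not be continuous in its first argument, the limit is taken after
  comparing \<open>gradft i (xt n i) (x n i)\<close> with \<open>gradft i (xt n i) (xt n i) = gradf i (xt n i)\<close>.\<close>

lemma limit_point_stationary:
  assumes "seq_limit_point xb q"
  shows "stationary K gradF G q"
proof -
  obtain r where r: "strict_mono r" and q: "(xb \<circ> r) \<longlonglongrightarrow> q"
    using assms by (auto simp: seq_limit_point_def)
  have qK: "q \<in> K" by (rule closed_sequentially[OF K(1) _ q]) (simp add: xb_in)
  \<comment> \<open>The subproblem of a single agent, here agent 0, already carries the full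
    gradient in the limit.\<close>
  have i: "0 < I" using I_pos by simp
  have d0: "(\<lambda>n. d n 0) \<longlonglongrightarrow> 0"
    by (rule Lim_null_comparison[OF _ limits(3)]) (simp add: norm_le_total_norm i)
  have e0: "(\<lambda>n. x n 0 - xb n) \<longlonglongrightarrow> 0"
    by (rule tendsto_norm_zero_cancel) (rule consensus[OF i])
  have sub: "(\<lambda>n. h (r n)) \<longlonglongrightarrow> l" if "h \<longlonglongrightarrow> l" for h :: "nat \<Rightarrow> 'b::topological_space" and l
    using LIMSEQ_subseq_LIMSEQ[OF that r] by (simp add: o_def)
  define err where "err n = gradft 0 (xt n 0) (x n 0) + pr n 0 - gradF (xb n)" for n
  have err: "norm (err n) \<le> Lip * norm (xt n 0 - x n 0) + Lip * norm (d n 0) + (3 * Lip + I) * (X n + Y n) + Lip * X n" for n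
  proof -
    let ?a = "gradft 0 (xt n 0) (x n 0) - gradft 0 (xt n 0) (xt n 0)"
      and ?b = "gradf 0 (xt n 0) - gradf 0 (xb n)"
      and ?c = "gradft 0 (xb n) (x n 0) + pr n 0 - gradF (xb n)"
      and ?e = "gradft 0 (xb n) (xb n) - gradft 0 (xb n) (x n 0)"
    \<comment> \<open>The first argument moves from \<open>xt n 0\<close> to \<open>xb n\<close>
      along the diagonal: \<open>?a\<close> enters it, \<open>?b\<close> travels, \<open>?e\<close>
      leaves, and \<open>?c\<close> is the known gradient error.\<close>
    have "err n = ?a + ?b + ?c + ?e"
      by (simp add: err_def gradft_diag i xt_in xb_in)
    then have "norm (err n) \<le> norm ?a + norm ?b + norm ?c + norm ?e"
      by (simp only:) (intro order_trans[OF norm_triangle_ineq] add_right_mono norm_triangle_ineq)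
    moreover have "norm ?a \<le> Lip * norm (xt n 0 - x n 0)"
      using gradft_diff[OF i xt_in[OF i] x_in[OF i] xt_in[OF i]] by (metis norm_minus_commute)
    moreover have "norm ?b \<le> Lip * norm (d n 0)"
      unfolding d_def by (intro gradf_diff i xt_in xb_in)
    moreover have "norm ?e \<le> Lip * norm (x n 0 - xb n)"
      using gradft_diff[OF i xb_in xb_in x_in[OF i]] by (metis norm_minus_commute)
    moreover have "Lip * norm (x n 0 - xb n) \<le> Lip * X n"
      by (intro mult_left_mono norm_x_xb i Lip_nonneg)
    ultimately show ?thesis using gradient_error[OF i, of n] by linarith
  qed
  have diff: "(\<lambda>n. norm (xt n 0 - x n 0)) \<longlonglongrightarrow> 0"
    using tendsto_norm_zero[OF tendsto_diff[OF d0 e0, simplified]] by (simp add: d_def)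
  have err0: "err \<longlonglongrightarrow> 0"
  proof (rule Lim_null_comparison)
    show "\<forall>\<^sub>F n in sequentially. norm (err n) \<le> Lip * norm (xt n 0 - x n 0) + Lip * norm (d n 0)
        + (3 * Lip + I) * (X n + Y n) + Lip * X n"
      by (intro always_eventually allI err)
    have "(\<lambda>n. Lip * norm (xt n 0 - x n 0) + Lip * norm (d n 0) + (3 * Lip + I) * (X n + Y n) + Lip * X n)
        \<longlonglongrightarrow> Lip * 0 + Lip * norm (0::'a) + (3 * Lip + I) * (0 + 0) + Lip * 0"
      by (intro tendsto_intros diff d0 limits)
    then show "(\<lambda>n. Lip * norm (xt n 0 - x n 0) + Lip * norm (d n 0) + (3 * Lip + I) * (X n + Y n) + Lip * X n) \<longlonglongrightarrow> 0"
      by simp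
  qed
  have xb_lim: "(\<lambda>n. xb (r n)) \<longlonglongrightarrow> q" using q by (simp add: o_def)
  have xt_lim: "(\<lambda>n. xt (r n) 0) \<longlonglongrightarrow> q"
    using tendsto_add[OF sub[OF d0] xb_lim] by (simp add: d_def)
  have gradF_lim: "(\<lambda>n. gradF (xb (r n))) \<longlonglongrightarrow> gradF q"
    using lipschitz_on_continuous_on[OF gradF_lip] xb_lim qK
    by (rule continuous_on_tendsto_compose) (simp add: xb_in)
  have G_lim: "(\<lambda>n. G (xt (r n) 0)) \<longlonglongrightarrow> G q"
    using G_continuous xt_lim by (rule continuous_on_tendsto_compose) auto
  \<comment> \<open>Only values of \<open>G\<close> occur, so its continuity suffices; a subgradient
    is chosen only at \<open>q\<close>.\<close>
  have "0 \<le> gradF q \<bullet> (v - q) + G v - G q" if v: "v \<in> K" for v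
  proof (rule tendsto_lowerbound)
    show "(\<lambda>n. (err (r n) + gradF (xb (r n))) \<bullet> (v - xt (r n) 0) + G v - G (xt (r n) 0))
        \<longlonglongrightarrow> gradF q \<bullet> (v - q) + G v - G q"
      using tendsto_diff[OF tendsto_add[OF tendsto_inner[OF tendsto_add[OF sub[OF err0] gradF_lim]
            tendsto_diff[OF tendsto_const[of v] xt_lim]] tendsto_const[of "G v"]] G_lim] by simp
    show "\<forall>\<^sub>F n in sequentially. 0 \<le> (err (r n) + gradF (xb (r n))) \<bullet> (v - xt (r n) 0) + G v - G (xt (r n) 0)"
      using xt_vi[OF i v] by (simp add: err_def)
  qed simp
  then show ?thesis unfolding stationary_def
    using qK subdiff_variational_inequality[OF G_convex K(2) qK] by blast
qed

end

theorem theorem2: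
  fixes K :: "'a::euclidean_space set"
    and I :: nat
    and f :: "nat \<Rightarrow> 'a \<Rightarrow> real" and gradf :: "nat \<Rightarrow> 'a \<Rightarrow> 'a"
    and G :: "'a \<Rightarrow> real"
    and L :: "nat \<Rightarrow> real" and LF :: real and LG :: real
    and E :: "nat \<Rightarrow> (nat \<times> nat) set" and B :: nat
    and \<theta> :: "nat \<Rightarrow> nat \<Rightarrow> real" and \<theta>\<^sub>0 :: real
    and w :: "nat \<Rightarrow> nat \<Rightarrow> nat \<Rightarrow> real"
    and ft :: "nat \<Rightarrow> 'a \<Rightarrow> 'a \<Rightarrow> real" and gradft :: "nat \<Rightarrow> 'a \<Rightarrow> 'a \<Rightarrow> 'a"
    and \<tau> :: "nat \<Rightarrow> real"
    and \<alpha> :: "nat \<Rightarrow> real" and \<epsilon> :: "nat \<Rightarrow> nat \<Rightarrow> real"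
    and x y \<pi> xt xinx z :: "nat \<Rightarrow> nat \<Rightarrow> 'a"
  assumes I_pos: "I \<ge> 1"
    \<comment> \<open>(A1)\<close>
    and A1: "K \<noteq> {}" "closed K" "convex K"
    \<comment> \<open>(A2): each f i is C^1 on an open set containing K, with gradient gradf i\<close>
    and A2: "\<And>i. i < I \<Longrightarrow> \<exists>S. open S \<and> K \<subseteq> S \<and>
                 (\<forall>u\<in>S. (f i has_derivative (\<lambda>h. gradf i u \<bullet> h)) (at u)) \<and>
                 continuous_on S (gradf i)"
    \<comment> \<open>(A3)\<close>
    and A3: "\<And>i. i < I \<Longrightarrow> (L i)-lipschitz_on K (gradf i)"
    \<comment> \<open>(A4)\<close>
    and A4: "\<And>u. u \<in> K \<Longrightarrow> norm (\<Sum>i<I. gradf i u) \<le> LF"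
    \<comment> \<open>(A5)\<close>
    and A5: "convex_on UNIV G"
      "\<And>u \<xi>. u \<in> K \<Longrightarrow> \<xi> \<in> subdiff G u \<Longrightarrow> norm \<xi> \<le> LG"
    \<comment> \<open>(A6)\<close>
    and A6: "coercive_on K (\<lambda>u. (\<Sum>i<I. f i u) + G u)"
    \<comment> \<open>network and weights\<close>
    and E_agents: "\<And>n. E n \<subseteq> {..<I} \<times> {..<I}"
    and theta: "0 < \<theta>\<^sub>0" "\<theta>\<^sub>0 < 1" "\<And>i j. \<theta>\<^sub>0 \<le> \<theta> i j \<and> \<theta> i j \<le> 1"
    and w_def: "\<And>n i j. w n i j = (if j \<in> in_nbrs E n i then \<theta> i j else 0)"
    \<comment> \<open>(B1)\<close>
    and B1: "B > 0" "\<And>k i j. i < I \<Longrightarrow> j < I \<Longrightarrow>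
               (i, j) \<in> (\<Union>n\<in>{k*B..<(k+1)*B}. E n)\<^sup>*"
    \<comment> \<open>(B2)\<close>
    and B2: "\<And>n i. i < I \<Longrightarrow> (\<Sum>j<I. w n i j) = 1"
      "\<And>n j. j < I \<Longrightarrow> (\<Sum>i<I. w n i j) = 1"
    \<comment> \<open>surrogates: gradient w.r.t. the first argument\<close>
    and F_diff: "\<And>i u v. i < I \<Longrightarrow> u \<in> K \<Longrightarrow> v \<in> K \<Longrightarrow>
               ((\<lambda>s. ft i s v) has_derivative (\<lambda>h. gradft i u v \<bullet> h)) (at u within K)"
    \<comment> \<open>(F1)\<close>
    and F1: "\<And>i v. i < I \<Longrightarrow> v \<in> K \<Longrightarrow> \<tau> i > 0 \<and> strongly_convex_on K (\<tau> i) (\<lambda>s. ft i s v)"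
    \<comment> \<open>(F2)\<close>
    and F2: "\<And>i u. i < I \<Longrightarrow> u \<in> K \<Longrightarrow> gradft i u u = gradf i u"
    \<comment> \<open>(F3)\<close>
    and F3: "\<And>i. i < I \<Longrightarrow> \<exists>C. \<forall>u\<in>K. C-lipschitz_on K (\<lambda>v. gradft i u v)"
    \<comment> \<open>inexact NEXT iteration\<close>
    and init_x: "\<And>i. i < I \<Longrightarrow> x 0 i \<in> K"
    and init_y: "\<And>i. i < I \<Longrightarrow> y 0 i = gradf i (x 0 i)"
    and pi_def: "\<And>n i. i < I \<Longrightarrow> \<pi> n i = of_nat I *\<^sub>R y n i - gradf i (x n i)"
    and xt_min: "\<And>n i. i < I \<Longrightarrow> xt n i \<in> K \<and>
               (\<forall>v\<in>K. ft i (xt n i) (x n i) + \<pi> n i \<bullet> (xt n i - x n i) + G (xt n i)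
                     \<le> ft i v (x n i) + \<pi> n i \<bullet> (v - x n i) + G v)"
    and xinx: "\<And>n i. i < I \<Longrightarrow> xinx n i \<in> K \<and> norm (xinx n i - xt n i) \<le> \<epsilon> n i"
    and z_def: "\<And>n i. i < I \<Longrightarrow> z n i = x n i + \<alpha> n *\<^sub>R (xinx n i - x n i)"
    and x_upd: "\<And>n i. i < I \<Longrightarrow> x (Suc n) i = (\<Sum>j<I. w n i j *\<^sub>R z n j)"
    and y_upd: "\<And>n i. i < I \<Longrightarrow> y (Suc n) i =
               (\<Sum>j<I. w n i j *\<^sub>R y n j) + gradf i (x (Suc n) i) - gradf i (x n i)"
    \<comment> \<open>tolerances and step sizes\<close>
    and eps_nonneg: "\<And>n i. i < I \<Longrightarrow> \<epsilon> n i \<ge> 0"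
    and eps_bdd: "\<And>i. i < I \<Longrightarrow> bounded (range (\<lambda>n. \<epsilon> n i))"
    and alpha_range: "\<And>n. 0 < \<alpha> n \<and> \<alpha> n \<le> 1"
    and alpha_div: "\<not> summable \<alpha>"
    and alpha_sq: "summable (\<lambda>n. (\<alpha> n)\<^sup>2)"
    and alpha_eps: "\<And>i. i < I \<Longrightarrow> summable (\<lambda>n. \<alpha> n * \<epsilon> n i)"
  shows "bounded (range (\<lambda>n. (1 / of_nat I) *\<^sub>R (\<Sum>i<I. x n i)))
       \<and> (\<forall>p. seq_limit_point (\<lambda>n. (1 / of_nat I) *\<^sub>R (\<Sum>i<I. x n i)) p
              \<longrightarrow> stationary K (\<lambda>u. \<Sum>i<I. gradf i u) G p)
       \<and> (\<forall>i<I. (\<lambda>n. norm (x n i - (1 / of_nat I) *\<^sub>R (\<Sum>j<I. x n j))) \<longlonglongrightarrow> 0)"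
proof -
  obtain C where C: "\<And>i u. i < I \<Longrightarrow> u \<in> K \<Longrightarrow> (C i)-lipschitz_on K (gradft i u)"
    using F3 by metis
  define Lip where "Lip = (\<Sum>i<I. \<bar>L i\<bar> + \<bar>C i\<bar>)"
  have Lip: "L i \<le> Lip" "C i \<le> Lip" if "i < I" for i
    using member_le_sum[of i "{..<I}" "\<lambda>i. \<bar>L i\<bar> + \<bar>C i\<bar>"] that by (auto simp: Lip_def)
  define \<tau>\<^sub>0 where "\<tau>\<^sub>0 = Min (\<tau> ` {..<I})"
  \<comment> \<open>\<open>F1\<close> states positivity of \<open>\<tau> i\<close> relative to a
    point of \<open>K\<close>; nonemptiness supplies one.\<close>
  obtain u\<^sub>0 where u0: "u\<^sub>0 \<in> K" using A1(1) by blast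
  have ne: "\<tau> ` {..<I} \<noteq> {}" using I_pos by (auto simp: lessThan_empty_iff)
  have \<tau>\<^sub>0: "0 < \<tau>\<^sub>0" "\<And>i. i < I \<Longrightarrow> \<tau>\<^sub>0 \<le> \<tau> i"
    using ne F1[OF _ u0] by (auto simp: \<tau>\<^sub>0_def)
  define \<epsilon>\<^sub>0 where "\<epsilon>\<^sub>0 = (\<Sum>i<I. SUP n. \<epsilon> n i)"
  have eps_le: "\<epsilon> n i \<le> \<epsilon>\<^sub>0" if i: "i < I" for n i
  proof -
    have le: "\<epsilon> n j \<le> (SUP n. \<epsilon> n j)" if "j < I" for n j
      using eps_bdd[OF that] by (intro cSUP_upper bounded_imp_bdd_above) auto
    have "(SUP n. \<epsilon> n i) \<le> \<epsilon>\<^sub>0" unfolding \<epsilon>\<^sub>0_def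
      using i order_trans[OF eps_nonneg[of _ 0] le] by (intro member_le_sum) auto
    with le[OF i, of n] show ?thesis by simp
  qed
  have w_nonneg: "0 \<le> w n i j" for n i j
    using theta(1) theta(3)[of i j] by (simp add: w_def)
  interpret connected_gossip I w E B \<theta>\<^sub>0
  proof
    show "\<theta>\<^sub>0 \<le> w n i j" if "(j, i) \<in> E n" for n i j
      using that theta(3) by (simp add: w_def in_nbrs_def)
    show "\<theta>\<^sub>0 \<le> w n i i" for n i using theta(3) by (simp add: w_def in_nbrs_def)
  qed (use I_pos w_nonneg B2 E_agents theta B1 in auto)
  interpret next_iteration I w E B \<theta>\<^sub>0 K f gradf G gradft Lip \<tau>\<^sub>0 LF LG \<epsilon>\<^sub>0 \<alpha> \<epsilon> x y xt xinx
  proof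
    show "closed K" "convex K" "convex_on UNIV G" by fact+
    show "(f i has_derivative (\<lambda>h. gradf i u \<bullet> h)) (at u)" if "i < I" "u \<in> K" for i u
      using A2[OF that(1)] that(2) by blast
    show "Lip-lipschitz_on K (gradf i)" if "i < I" for i
      using A3[OF that] Lip(1)[OF that] by (rule lipschitz_on_le)
    show "norm (\<Sum>i<I. gradf i u) \<le> LF" if "u \<in> K" for u by (rule A4[OF that])
    show "G u - G v \<le> LG * norm (u - v)" if "u \<in> K" for u v
      by (rule convex_lipschitz_of_subdiff_bound[OF A5 that])
    show "0 \<le> LG" by (rule convex_lipschitz_of_subdiff_bound[OF A5 u0])
    show "coercive_on K (\<lambda>u. (\<Sum>i<I. f i u) + G u)" by fact
    show "0 < \<tau>\<^sub>0" by fact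
    show "\<tau>\<^sub>0 * (norm (v - u))\<^sup>2 \<le> (gradft i v r - gradft i u r) \<bullet> (v - u)"
      if "i < I" "u \<in> K" "v \<in> K" "r \<in> K" for i u v r
    proof -
      have "\<tau> i * (norm (v - u))\<^sup>2 \<le> (gradft i v r - gradft i u r) \<bullet> (v - u)"
        using F1[OF that(1,4)] F_diff[OF that(1) _ that(4)] that(2,3)
        by (intro strongly_convex_on_monotone[where g = "\<lambda>u. gradft i u r" and h = "\<lambda>u. ft i u r"]) auto
      moreover have "\<tau>\<^sub>0 * (norm (v - u))\<^sup>2 \<le> \<tau> i * (norm (v - u))\<^sup>2"
        by (intro mult_right_mono \<tau>\<^sub>0 that(1)) simp
      ultimately show ?thesis by simp
    qed
    show "Lip-lipschitz_on K (gradft i u)" if "i < I" "u \<in> K" for i u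
      using C[OF that] Lip(2)[OF that(1)] by (rule lipschitz_on_le)
    show "gradft i u u = gradf i u" if "i < I" "u \<in> K" for i u by (rule F2[OF that])
    show "x 0 i \<in> K" "y 0 i = gradf i (x 0 i)" if "i < I" for i
      using init_x init_y that by auto
    show xt_in: "xt n i \<in> K" if "i < I" for n i using xt_min[OF that] by blast
    show "x (Suc n) i = mix n (\<lambda>j. x n j + \<alpha> n *\<^sub>R (xinx n j - x n j)) i" if "i < I" for n i
      using x_upd[OF that] z_def by (simp add: mix_def)
    show "0 \<le> (gradft i (xt n i) (x n i) + (of_nat I *\<^sub>R y n i - gradf i (x n i))) \<bullet> (v - xt n i)
        + G v - G (xt n i)" if i: "i < I" and x_in: "x n i \<in> K" and "v \<in> K" for n i v
      unfolding pi_def[OF i, symmetric]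
      using xt_min[OF i, of n] \<open>v \<in> K\<close>
      by (intro composite_minimizer_variational_inequality[OF A1(3) xt_in[OF i]
            F_diff[OF i xt_in[OF i] x_in] A5(1)]) auto
    show "xinx n i \<in> K" "norm (xinx n i - xt n i) \<le> \<epsilon> n i" if "i < I" for n i
      using xinx[OF that] by auto
    show "y (Suc n) i = mix n (y n) i + (gradf i (x (Suc n) i) - gradf i (x n i))" if "i < I" for n i
      using y_upd[OF that] by (simp add: mix_def)
    show "\<epsilon> n i \<le> \<epsilon>\<^sub>0" if "i < I" for n i by (rule eps_le[OF that])
    show "0 < \<alpha> n" "\<alpha> n \<le> 1" for n using alpha_range by auto
    show "\<not> summable \<alpha>" "summable (\<lambda>n. (\<alpha> n)\<^sup>2)" by fact+
    show "summable (\<lambda>n. \<alpha> n * \<epsilon> n i)" if "i < I" for i by (rule alpha_eps[OF that])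
  qed
  have xb_eq: "(\<lambda>n. (1 / of_nat I) *\<^sub>R (\<Sum>i<I. x n i)) = xb"
    by (simp add: fun_eq_iff xb_def mean_def)
  have gradF_eq: "(\<lambda>u. \<Sum>i<I. gradf i u) = gradF"
    by (simp add: fun_eq_iff gradF_def)
  show ?thesis
    unfolding xb_eq gradF_eq fun_cong[OF xb_eq]
    using xb_bounded limit_point_stationary consensus by blast
qed

end
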